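(* Let $R$ be a unital topological ring, let $\pi\colon\Lambda\to\Gamma$ be a continuous $R$-bundle, where $\Gamma$ is an étale locally $R$-normal semigroupoid, let $\sim$ be a bundle congruence on $\pi$, and let $T\colon\mathcal{A}(\pi)\to\mathcal{A}(\pi/\!\sim)$ be the homomorphism $T(\alpha)(x)=\sum_{\gamma\in x}p_\Lambda(\alpha(\gamma))$ for $x\in\Gamma/\!\sim$, where $p_\Lambda\colon\Lambda\to\Lambda/\!\sim$ is the quotient map. Suppose moreover that $\pi$ is a local homeomorphism, and that the zero set $\mathbf{0}(\Gamma)=\{0_\gamma:\gamma\in\Gamma\}$ is $\sim_\Lambda$-saturated (i.e. $x\sim_\Lambda 0_\gamma$ for some $\gamma\in\Gamma$ implies $x=0_{\pi(x)}$). Then the kernel of $T$ is generated as an additive group by the set $\mathbf{K}$ of all sections of the form $\alpha-\psi\alpha\varphi$, where $\psi\alpha\varphi$ is a section conjugate to $\alpha$.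
   Context: A space has a property "locally" if every point has a neighbourhood basis (neighbourhoods not necessarily open) of subsets having that property in the subspace topology. A space $X$ is $R$-normal if for any disjoint closed $A,B\subseteq X$ there is a continuous $f\colon X\to R$ with $f=0$ on $A$, $f=1$ on $B$. A semigroupoid $\Lambda$ is a directed graph with vertex set $\Lambda^{(0)}$, source and range maps $\mathfrak{s},\mathfrak{r}\colon\Lambda\to\Lambda^{(0)}$, and an associative product $\Lambda^{(2)}=\{(a,b):\mathfrak{s}(a)=\mathfrak{r}(b)\}\to\Lambda$ with $\mathfrak{s}(ab)=\mathfrak{s}(b)$, $\mathfrak{r}(ab)=\mathfrak{r}(a)$. A homomorphism $\phi$ satisfies: $(a,b)$ composable implies $(\phi(a),\phi(b))$ composable and $\phi(ab)=\phi(a)\phi(b)$; it is rigid if conversely $(\phi(a),\phi(b))$ composable implies $(a,b)$ composable. Topological semigroupoid: $\mathfrak{s},\mathfrak{r}$ and product continuous. Étale: $\mathfrak{s},\mathfrak{r}$ are local homeomorphisms and $\Lambda^{(0)}$ is locally compact Hausdorff. An $R$-bundle is a rigid semigroupoid homomorphism $\pi\colon\Lambda\to\Gamma$ with an $R$-bimodule structure on each fiber $\pi^{-1}(\gamma)$, $\gamma\in\Gamma$, such that for $(\gamma_1,\gamma_2)\in\Gamma^{(2)}$ the product $\pi^{-1}(\gamma_1)\times\pi^{-1}(\gamma_2)\to\pi^{-1}(\gamma_1\gamma_2)$ is biadditive, satisfies $(xr)y=x(ry)$, and induces an $R$-bimodule homomorphism on $\pi^{-1}(\gamma_1)\otimes_R\pi^{-1}(\gamma_2)$.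 $0_\gamma$ is the zero of $\pi^{-1}(\gamma)$. The bundle is continuous if $\Lambda,\Gamma$ are topological semigroupoids and $\pi$, the fiberwise addition, the left and right scalar multiplications, and $\gamma\mapsto0_\gamma$ are continuous. A section of $\pi$ is a map $\alpha\colon\Gamma\to\Lambda$ with $\pi\circ\alpha=\mathrm{id}_\Gamma$; $\operatorname{supp}(\alpha)$ is the closure of $\{\gamma:\alpha(\gamma)\ne0_\gamma\}$. For $V\subseteq\Gamma$ open, $C_c(V,\pi)$ is the set of sections that are zero outside $V$, continuous on $V$, with $\operatorname{supp}(\alpha)\cap V$ compact. For $\Gamma$ étale and locally $R$-normal, the sectional algebra $\mathcal{A}(\pi)$ is the $R$-bimodule (pointwise operations) generated by all $C_c(V,\pi)$, $V$ open Hausdorff, with product $(\alpha\ast\beta)(\gamma)=\sum_{ab=\gamma}\alpha(a)\beta(b)$. An equivalence relation on a space is open if the saturation of every open set is open. A rigid congruence on a semigroupoid is an equivalence relation $\sim$ such that $x\sim y$ implies $\mathfrak{s}(x)=\mathfrak{s}(y)$ and $\mathfrak{r}(x)=\mathfrak{r}(y)$, and $x_1\sim y_1$, $x_2\sim y_2$, $\mathfrak{s}(x_1)=\mathfrak{r}(x_2)$ imply $x_1x_2\sim y_1y_2$. The quotient $\Lambda/\!\sim$ by an open rigid congruence, with the quotient topology, is a topological semigroupoid over the same vertex space with $\overline{x}\,\overline{y}=\overline{xy}$; if $\Lambda$ is étale (and locally $R$-normal) so is the quotient. A bundle congruence $\sim$ on $\pi$ consists of open rigid congruences $\sim_\Gamma$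 on $\Gamma$ and $\sim_\Lambda$ on $\Lambda$ such that: (i) $x\sim_\Lambda y$ implies $\pi(x)\sim_\Gamma\pi(y)$; (ii) if $x_1\sim_\Lambda x_2$, $y_1\sim_\Lambda y_2$, $\pi(x_1)=\pi(y_1)$, $\pi(x_2)=\pi(y_2)$, then $x_1+y_1\sim_\Lambda x_2+y_2$, and similarly $rx_1\sim_\Lambda rx_2$, $x_1r\sim_\Lambda x_2r$ for $r\in R$; (iii) if $\pi(x)\sim_\Gamma\pi(y)$ then there is $y'\in\Lambda$ with $y\sim_\Lambda y'$ and $\pi(x)=\pi(y')$. The quotient bundle $\pi/\!\sim\colon\Lambda/\!\sim_\Lambda\to\Gamma/\!\sim_\Gamma$ is the map induced by $\pi$, with fiberwise operations $p_\Lambda(x)+p_\Lambda(y)=p_\Lambda(x+y')$ ($y'\sim_\Lambda y$, $\pi(y')=\pi(x)$), $rp_\Lambda(x)=p_\Lambda(rx)$, $p_\Lambda(x)r=p_\Lambda(xr)$. Conjugate sections: suppose $\alpha\in C_c(V,\pi)$ for some open Hausdorff $V\subseteq\Gamma$; $W\subseteq\Gamma$ is open; $\varphi\colon W\to V$ is a homeomorphism with $\gamma\sim_\Gamma\varphi(\gamma)$ for all $\gamma\in W$; $A,B\subseteq\Lambda$ are open with $\alpha(V)\subseteq A$; and $\psi\colon A\to B$ is a homeomorphism with $x\sim_\Lambda\psi(x)$ for all $x\in A$ and $\pi\circ\psi\circ\alpha\circ\varphi=\mathrm{id}_W$. Then $\psi\alpha\varphi\colon\Gamma\to\Lambda$,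 equal to $\psi\circ\alpha\circ\varphi$ on $W$ and zero on $\Gamma\setminus W$, is called the section conjugate to $\alpha$ via $\varphi$ and $\psi$. (When $\mathbf{0}(\Gamma)$ is $\sim_\Lambda$-saturated, $\psi\alpha\varphi\in C_c(W,\pi)$.) *)

theory Defs
  imports "HOL-Analysis.Analysis" "HOL-Algebra.AbelCoset" "HOL-Algebra.Generated_Groups"
begin

section \<open>Topological preliminaries\<close>

definition local_homeomorphism :: "'a topology \<Rightarrow> 'b topology \<Rightarrow> ('a \<Rightarrow> 'b) \<Rightarrow> bool" where
  "local_homeomorphism X Y f \<longleftrightarrow>
     (\<forall>x\<in>topspace X. \<exists>U. openin X U \<and> x \<in> U \<and> openin Y (f ` U) \<and>
        homeomorphic_map (subtopology X U) (subtopology Y (f ` U)) f)"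

text \<open>The sort \<open>{ring, topological_ab_group_add, topological_monoid_mult}\<close> used below describes
  unital topological rings. In contrast to \<open>ring_1\<close> it does not require \<open>0 \<noteq> 1\<close>.\<close>

definition R_normal ::
    "'r::{ring, topological_ab_group_add, topological_monoid_mult} itself \<Rightarrow> 'a topology \<Rightarrow> bool" where
  "R_normal _ X \<longleftrightarrow>
     (\<forall>A B. closedin X A \<and> closedin X B \<and> disjnt A B \<longrightarrow>
        (\<exists>f :: 'a \<Rightarrow> 'r. continuous_map X euclidean f \<and> (\<forall>x\<in>A. f x = 0) \<and> (\<forall>x\<in>B. f x = 1)))"

definition locally_R_normal ::
    "'r::{ring, topological_ab_group_add, topological_monoid_mult} itself \<Rightarrow> 'a topology \<Rightarrow> bool" where
  "locally_R_normal R X \<longleftrightarrow> neighbourhood_base_of (\<lambda>S. R_normal R (subtopology X S)) X"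

definition open_equivalence :: "'a topology \<Rightarrow> 'a rel \<Rightarrow> bool" where
  "open_equivalence X r \<longleftrightarrow> equiv (topspace X) r \<and> (\<forall>U. openin X U \<longrightarrow> openin X (r `` U))"

text \<open>For a set \<open>\<U>\<close> of equivalence classes, \<open>\<Union>\<U>\<close> is its preimage under the quotient map.\<close>

definition quotient_topology :: "'a topology \<Rightarrow> 'a rel \<Rightarrow> 'a set topology" where
  "quotient_topology X r = topology (\<lambda>\<U>. \<U> \<subseteq> topspace X // r \<and> openin X (\<Union>\<U>))"

lemma openin_quotient_topology:
  assumes "equiv (topspace X) r"
  shows "openin (quotient_topology X r) \<U> \<longleftrightarrow> \<U> \<subseteq> topspace X // r \<and> openin X (\<Union>\<U>)"
proof -
  have int: "\<Union>(S \<inter> T) = \<Union>S \<inter> \<Union>T" if "S \<subseteq> topspace X // r" "T \<subseteq> topspace X // r" for S T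
  proof (intro equalityI subsetI)
    fix x assume "x \<in> \<Union>S \<inter> \<Union>T"
    then obtain C D where CD: "C \<in> S" "D \<in> T" "x \<in> C" "x \<in> D"
      by blast
    then have "C = D"
      using quotient_disj[OF assms, of C D] that by blast
    then show "x \<in> \<Union>(S \<inter> T)"
      using CD by blast
  qed blast
  have Un: "\<Union>(\<Union>K) = \<Union>(Union ` K)" for K :: "'a set set set"
    by auto
  have "istopology (\<lambda>\<U>. \<U> \<subseteq> topspace X // r \<and> openin X (\<Union>\<U>))"
    unfolding istopology_def
  proof (intro conjI allI impI; (elim conjE)?)
    fix S T assume "S \<subseteq> topspace X // r" "openin X (\<Union>S)" "T \<subseteq> topspace X // r" "openin X (\<Union>T)"
    then show "openin X (\<Union>(S \<inter> T))"
      by (simp add: int openin_Int)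
  next
    fix K assume "\<forall>S\<in>K. S \<subseteq> topspace X // r \<and> openin X (\<Union>S)"
    then show "openin X (\<Union>(\<Union>K))"
      unfolding Un by (intro openin_Union) auto
  qed auto
  then show ?thesis
    by (simp add: quotient_topology_def topology_inverse')
qed

lemma topspace_quotient_topology:
  assumes "equiv (topspace X) r"
  shows "topspace (quotient_topology X r) = topspace X // r"
proof
  show "topspace (quotient_topology X r) \<subseteq> topspace X // r"
    using openin_quotient_topology[OF assms] openin_topspace by blast
  have "openin (quotient_topology X r) (topspace X // r)"
    by (simp add: openin_quotient_topology[OF assms] Union_quotient[OF assms])
  then show "topspace X // r \<subseteq> topspace (quotient_topology X r)"
    by (rule openin_subset)
qed

lemma quotient_map_quotient_topology:
  assumes "equiv (topspace X) r"
  shows "quotient_map X (quotient_topology X r) (\<lambda>x. r `` {x})"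
proof -
  have "{x \<in> topspace X. r `` {x} \<in> \<U>} = \<Union>\<U>" if "\<U> \<subseteq> topspace X // r" for \<U>
  proof (intro Set.set_eqI iffI)
    fix x assume "x \<in> {x \<in> topspace X. r `` {x} \<in> \<U>}"
    then show "x \<in> \<Union>\<U>"
      by (intro UnionI[of "r `` {x}"] equiv_class_self[OF assms]) simp_all
  next
    fix x assume "x \<in> \<Union>\<U>"
    then obtain C where C: "C \<in> \<U>" "x \<in> C"
      by (rule UnionE)
    then have "C \<in> topspace X // r"
      using that by (meson subsetD)
    then obtain y where y: "y \<in> topspace X" "C = r `` {y}"
      by (rule quotientE)
    then have "(y, x) \<in> r"
      using C(2) by simp
    then have "r `` {x} = C" "x \<in> topspace X"
      using equiv_class_eq_iff[OF assms, of y x] y by simp_all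
    then show "x \<in> {x \<in> topspace X. r `` {x} \<in> \<U>}"
      using C(1) by simp
  qed
  then show ?thesis
    unfolding quotient_map_def topspace_quotient_topology[OF assms]
    by (simp add: openin_quotient_topology[OF assms] proj_image[unfolded Equiv_Relations.proj_def])
qed


section \<open>Semigroupoids\<close>

text \<open>Arrow and vertex sets are the underlying sets of the two topologies. The vertices are not
  assumed to be arrows.\<close>

record ('a, 'v) semigroupoid =
  arrow_top :: "'a topology"
  vertex_top :: "'v topology"
  src :: "'a \<Rightarrow> 'v"
  rng :: "'a \<Rightarrow> 'v"
  arr_mult :: "'a \<Rightarrow> 'a \<Rightarrow> 'a"

abbreviation arrows :: "('a, 'v) semigroupoid \<Rightarrow> 'a set" where
  "arrows S \<equiv> topspace (arrow_top S)"

abbreviation vertices :: "('a, 'v) semigroupoid \<Rightarrow> 'v set" where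
  "vertices S \<equiv> topspace (vertex_top S)"

definition composable :: "('a, 'v) semigroupoid \<Rightarrow> ('a \<times> 'a) set" where
  "composable S = {(a, b). a \<in> arrows S \<and> b \<in> arrows S \<and> src S a = rng S b}"

definition semigroupoid :: "('a, 'v) semigroupoid \<Rightarrow> bool" where
  "semigroupoid S \<longleftrightarrow>
     src S \<in> arrows S \<rightarrow> vertices S \<and>
     rng S \<in> arrows S \<rightarrow> vertices S \<and>
     (\<forall>(a, b)\<in>composable S.
        arr_mult S a b \<in> arrows S \<and>
        src S (arr_mult S a b) = src S b \<and>
        rng S (arr_mult S a b) = rng S a) \<and>
     (\<forall>a b c. (a, b) \<in> composable S \<and> (b, c) \<in> composable S \<longrightarrow>
        arr_mult S (arr_mult S a b) c = arr_mult S a (arr_mult S b c))"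

definition topological_semigroupoid :: "('a, 'v) semigroupoid \<Rightarrow> bool" where
  "topological_semigroupoid S \<longleftrightarrow>
     semigroupoid S \<and>
     continuous_map (arrow_top S) (vertex_top S) (src S) \<and>
     continuous_map (arrow_top S) (vertex_top S) (rng S) \<and>
     continuous_map (subtopology (prod_topology (arrow_top S) (arrow_top S)) (composable S))
       (arrow_top S) (\<lambda>(a, b). arr_mult S a b)"

definition etale :: "('a, 'v) semigroupoid \<Rightarrow> bool" where
  "etale S \<longleftrightarrow>
     topological_semigroupoid S \<and>
     local_homeomorphism (arrow_top S) (vertex_top S) (src S) \<and>
     local_homeomorphism (arrow_top S) (vertex_top S) (rng S) \<and>
     Hausdorff_space (vertex_top S) \<and>
     neighbourhood_base_of (compactin (vertex_top S)) (vertex_top S)"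

definition semigroupoid_hom ::
    "('a, 'v) semigroupoid \<Rightarrow> ('b, 'w) semigroupoid \<Rightarrow> ('a \<Rightarrow> 'b) \<Rightarrow> bool" where
  "semigroupoid_hom S S' \<phi> \<longleftrightarrow>
     \<phi> \<in> arrows S \<rightarrow> arrows S' \<and>
     (\<forall>(a, b)\<in>composable S.
        (\<phi> a, \<phi> b) \<in> composable S' \<and> \<phi> (arr_mult S a b) = arr_mult S' (\<phi> a) (\<phi> b))"

definition rigid_hom ::
    "('a, 'v) semigroupoid \<Rightarrow> ('b, 'w) semigroupoid \<Rightarrow> ('a \<Rightarrow> 'b) \<Rightarrow> bool" where
  "rigid_hom S S' \<phi> \<longleftrightarrow>
     semigroupoid_hom S S' \<phi> \<and>
     (\<forall>a\<in>arrows S. \<forall>b\<in>arrows S. (\<phi> a, \<phi> b) \<in> composable S' \<longrightarrow> (a, b) \<in> composable S)"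

definition rigid_congruence :: "('a, 'v) semigroupoid \<Rightarrow> 'a rel \<Rightarrow> bool" where
  "rigid_congruence S r \<longleftrightarrow>
     equiv (arrows S) r \<and>
     (\<forall>(x, y)\<in>r. src S x = src S y \<and> rng S x = rng S y) \<and>
     (\<forall>(x\<^sub>1, y\<^sub>1)\<in>r. \<forall>(x\<^sub>2, y\<^sub>2)\<in>r. src S x\<^sub>1 = rng S x\<^sub>2 \<longrightarrow>
        (arr_mult S x\<^sub>1 x\<^sub>2, arr_mult S y\<^sub>1 y\<^sub>2) \<in> r)"

definition open_rigid_congruence :: "('a, 'v) semigroupoid \<Rightarrow> 'a rel \<Rightarrow> bool" where
  "open_rigid_congruence S r \<longleftrightarrow> rigid_congruence S r \<and> open_equivalence (arrow_top S) r"

text \<open>Source and range are constant on the classes of a rigid congruence, and the unions below are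
  taken over representatives of the factors, all of which yield the same class.\<close>

definition quotient_semigroupoid ::
    "('a, 'v) semigroupoid \<Rightarrow> 'a rel \<Rightarrow> ('a set, 'v) semigroupoid" where
  "quotient_semigroupoid S r =
     \<lparr> arrow_top = quotient_topology (arrow_top S) r,
       vertex_top = vertex_top S,
       src = (\<lambda>X. the_elem (src S ` X)),
       rng = (\<lambda>X. the_elem (rng S ` X)),
       arr_mult = (\<lambda>X Y. \<Union>x\<in>X. \<Union>y\<in>Y. r `` {arr_mult S x y}) \<rparr>"


section \<open>Bundles of bimodules\<close>

definition bimodule ::
    "'m monoid \<Rightarrow> ('r::{ring, monoid_mult} \<Rightarrow> 'm \<Rightarrow> 'm) \<Rightarrow> ('m \<Rightarrow> 'r \<Rightarrow> 'm) \<Rightarrow> bool" where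
  "bimodule M l r \<longleftrightarrow>
     comm_group M \<and>
     (\<forall>x\<in>carrier M.
        l 1 x = x \<and> r x 1 = x \<and>
        (\<forall>a b. l a x \<in> carrier M \<and> r x a \<in> carrier M \<and>
           l (a + b) x = l a x \<otimes>\<^bsub>M\<^esub> l b x \<and> r x (a + b) = r x a \<otimes>\<^bsub>M\<^esub> r x b \<and>
           l (a * b) x = l a (l b x) \<and> r x (a * b) = r (r x a) b \<and>
           l a (r x b) = r (l a x) b) \<and>
        (\<forall>y\<in>carrier M. \<forall>a.
           l a (x \<otimes>\<^bsub>M\<^esub> y) = l a x \<otimes>\<^bsub>M\<^esub> l a y \<and> r (x \<otimes>\<^bsub>M\<^esub> y) a = r x a \<otimes>\<^bsub>M\<^esub> r y a))"

record ('r, 'l, 'w, 'g, 'v) bundle_data =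
  total_space :: "('l, 'w) semigroupoid"
  base_space :: "('g, 'v) semigroupoid"
  bundle_proj :: "'l \<Rightarrow> 'g"
  fib_add :: "'l \<Rightarrow> 'l \<Rightarrow> 'l"
  fib_zero :: "'g \<Rightarrow> 'l"
  lsmul :: "'r \<Rightarrow> 'l \<Rightarrow> 'l"
  rsmul :: "'l \<Rightarrow> 'r \<Rightarrow> 'l"

definition fiber :: "('r, 'l, 'w, 'g, 'v) bundle_data \<Rightarrow> 'g \<Rightarrow> 'l set" where
  "fiber P \<gamma> = {x \<in> arrows (total_space P). bundle_proj P x = \<gamma>}"

definition fiber_group :: "('r, 'l, 'w, 'g, 'v) bundle_data \<Rightarrow> 'g \<Rightarrow> 'l monoid" where
  "fiber_group P \<gamma> = \<lparr> carrier = fiber P \<gamma>, monoid.mult = fib_add P, one = fib_zero P \<gamma> \<rparr>"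

text \<open>In the last part, the first three equations say that the product of fibers is biadditive and
  balanced, so that it induces an additive map on the tensor product over \<open>R\<close>; the last two say
  (on elementary tensors, which generate) that this map is a homomorphism of bimodules.\<close>

definition R_bundle ::
    "('r::{ring, monoid_mult}, 'l, 'w, 'g, 'v) bundle_data \<Rightarrow> bool" where
  "R_bundle P \<longleftrightarrow>
     semigroupoid (total_space P) \<and> semigroupoid (base_space P) \<and>
     rigid_hom (total_space P) (base_space P) (bundle_proj P) \<and>
     (\<forall>\<gamma>\<in>arrows (base_space P). bimodule (fiber_group P \<gamma>) (lsmul P) (rsmul P)) \<and>
     (let m = arr_mult (total_space P) in
      \<forall>(\<gamma>\<^sub>1, \<gamma>\<^sub>2)\<in>composable (base_space P).
      \<forall>x\<in>fiber P \<gamma>\<^sub>1. \<forall>x'\<in>fiber P \<gamma>\<^sub>1. \<forall>y\<in>fiber P \<gamma>\<^sub>2. \<forall>y'\<in>fiber P \<gamma>\<^sub>2. \<forall>r.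
        m (fib_add P x x') y = fib_add P (m x y) (m x' y) \<and>
        m x (fib_add P y y') = fib_add P (m x y) (m x y') \<and>
        m (rsmul P x r) y = m x (lsmul P r y) \<and>
        m (lsmul P r x) y = lsmul P r (m x y) \<and>
        m x (rsmul P y r) = rsmul P (m x y) r)"

definition continuous_bundle ::
    "('r::{ring, topological_ab_group_add, topological_monoid_mult}, 'l, 'w, 'g, 'v) bundle_data \<Rightarrow> bool"
  where
  "continuous_bundle P \<longleftrightarrow>
     R_bundle P \<and>
     topological_semigroupoid (total_space P) \<and> topological_semigroupoid (base_space P) \<and>
     (let L = arrow_top (total_space P); G = arrow_top (base_space P) in
        continuous_map L G (bundle_proj P) \<and>
        continuous_map
          (subtopology (prod_topology L L)
             {(x, y). x \<in> topspace L \<and> y \<in> topspace L \<and> bundle_proj P x = bundle_proj P y})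
          L (\<lambda>(x, y). fib_add P x y) \<and>
        continuous_map (prod_topology euclidean L) L (\<lambda>(r, x). lsmul P r x) \<and>
        continuous_map (prod_topology L euclidean) L (\<lambda>(x, r). rsmul P x r) \<and>
        continuous_map G L (fib_zero P))"


section \<open>Sections and the sectional algebra\<close>

definition bundle_sections :: "('r, 'l, 'w, 'g, 'v) bundle_data \<Rightarrow> ('g \<Rightarrow> 'l) set" where
  "bundle_sections P = (\<Pi>\<^sub>E \<gamma>\<in>arrows (base_space P). fiber P \<gamma>)"

definition section_supp :: "('r, 'l, 'w, 'g, 'v) bundle_data \<Rightarrow> ('g \<Rightarrow> 'l) \<Rightarrow> 'g set" where
  "section_supp P \<alpha> =
     arrow_top (base_space P) closure_of {\<gamma> \<in> arrows (base_space P). \<alpha> \<gamma> \<noteq> fib_zero P \<gamma>}"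

definition Cc :: "('r, 'l, 'w, 'g, 'v) bundle_data \<Rightarrow> 'g set \<Rightarrow> ('g \<Rightarrow> 'l) set" where
  "Cc P V = {\<alpha> \<in> bundle_sections P.
     (\<forall>\<gamma>\<in>arrows (base_space P) - V. \<alpha> \<gamma> = fib_zero P \<gamma>) \<and>
     continuous_map (subtopology (arrow_top (base_space P)) V) (arrow_top (total_space P)) \<alpha> \<and>
     compactin (arrow_top (base_space P)) (section_supp P \<alpha> \<inter> V)}"

definition section_add ::
    "('r, 'l, 'w, 'g, 'v) bundle_data \<Rightarrow> ('g \<Rightarrow> 'l) \<Rightarrow> ('g \<Rightarrow> 'l) \<Rightarrow> 'g \<Rightarrow> 'l" where
  "section_add P \<alpha> \<beta> = (\<lambda>\<gamma>\<in>arrows (base_space P). fib_add P (\<alpha> \<gamma>) (\<beta> \<gamma>))"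

definition section_diff ::
    "('r, 'l, 'w, 'g, 'v) bundle_data \<Rightarrow> ('g \<Rightarrow> 'l) \<Rightarrow> ('g \<Rightarrow> 'l) \<Rightarrow> 'g \<Rightarrow> 'l" where
  "section_diff P \<alpha> \<beta> =
     (\<lambda>\<gamma>\<in>arrows (base_space P). fib_add P (\<alpha> \<gamma>) (inv\<^bsub>fiber_group P \<gamma>\<^esub> (\<beta> \<gamma>)))"

definition section_lsmul ::
    "('r, 'l, 'w, 'g, 'v) bundle_data \<Rightarrow> 'r \<Rightarrow> ('g \<Rightarrow> 'l) \<Rightarrow> 'g \<Rightarrow> 'l" where
  "section_lsmul P r \<alpha> = (\<lambda>\<gamma>\<in>arrows (base_space P). lsmul P r (\<alpha> \<gamma>))"

definition section_rsmul ::
    "('r, 'l, 'w, 'g, 'v) bundle_data \<Rightarrow> ('g \<Rightarrow> 'l) \<Rightarrow> 'r \<Rightarrow> 'g \<Rightarrow> 'l" where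
  "section_rsmul P \<alpha> r = (\<lambda>\<gamma>\<in>arrows (base_space P). rsmul P (\<alpha> \<gamma>) r)"

text \<open>The sub-bimodule generated by the sets \<open>Cc P V\<close>. It contains the zero section
  (take \<open>V = {}\<close>) and is closed under negation, which is scalar multiplication by \<open>-1\<close>.\<close>

inductive_set sectional_carrier :: "('r, 'l, 'w, 'g, 'v) bundle_data \<Rightarrow> ('g \<Rightarrow> 'l) set"
  for P where
  Cc: "\<lbrakk>openin (arrow_top (base_space P)) V;
        Hausdorff_space (subtopology (arrow_top (base_space P)) V); \<alpha> \<in> Cc P V\<rbrakk>
       \<Longrightarrow> \<alpha> \<in> sectional_carrier P"
| add: "\<lbrakk>\<alpha> \<in> sectional_carrier P; \<beta> \<in> sectional_carrier P\<rbrakk>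
       \<Longrightarrow> section_add P \<alpha> \<beta> \<in> sectional_carrier P"
| lsmul: "\<alpha> \<in> sectional_carrier P \<Longrightarrow> section_lsmul P r \<alpha> \<in> sectional_carrier P"
| rsmul: "\<alpha> \<in> sectional_carrier P \<Longrightarrow> section_rsmul P \<alpha> r \<in> sectional_carrier P"

text \<open>\<open>finprod\<close> over an infinite index set is the neutral element, so sums with finitely many
  nonzero terms have to be restricted to these terms.\<close>

definition fiber_sum ::
    "('r, 'l, 'w, 'g, 'v) bundle_data \<Rightarrow> 'g \<Rightarrow> ('i \<Rightarrow> 'l) \<Rightarrow> 'i set \<Rightarrow> 'l" where
  "fiber_sum P \<gamma> f I = finprod (fiber_group P \<gamma>) f {i \<in> I. f i \<noteq> fib_zero P \<gamma>}"

definition convolution ::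
    "('r, 'l, 'w, 'g, 'v) bundle_data \<Rightarrow> ('g \<Rightarrow> 'l) \<Rightarrow> ('g \<Rightarrow> 'l) \<Rightarrow> 'g \<Rightarrow> 'l" where
  "convolution P \<alpha> \<beta> = (\<lambda>\<gamma>\<in>arrows (base_space P).
     fiber_sum P \<gamma> (\<lambda>(a, b). arr_mult (total_space P) (\<alpha> a) (\<beta> b))
       {(a, b) \<in> composable (base_space P). arr_mult (base_space P) a b = \<gamma>})"

text \<open>The sectional algebra need not have a unit; the field \<open>one\<close>, which the record type
  prescribes, is left unspecified.\<close>

definition sectional_algebra :: "('r, 'l, 'w, 'g, 'v) bundle_data \<Rightarrow> ('g \<Rightarrow> 'l) ring" where
  "sectional_algebra P =
     \<lparr> carrier = sectional_carrier P, monoid.mult = convolution P, one = undefined,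
       ring.zero = (\<lambda>\<gamma>\<in>arrows (base_space P). fib_zero P \<gamma>), ring.add = section_add P \<rparr>"


section \<open>Bundle congruences\<close>

definition bundle_congruence ::
    "('r, 'l, 'w, 'g, 'v) bundle_data \<Rightarrow> 'g rel \<Rightarrow> 'l rel \<Rightarrow> bool" where
  "bundle_congruence P rG rL \<longleftrightarrow>
     open_rigid_congruence (base_space P) rG \<and>
     open_rigid_congruence (total_space P) rL \<and>
     (\<forall>(x, y)\<in>rL. (bundle_proj P x, bundle_proj P y) \<in> rG) \<and>
     (\<forall>(x\<^sub>1, x\<^sub>2)\<in>rL. \<forall>(y\<^sub>1, y\<^sub>2)\<in>rL. bundle_proj P x\<^sub>1 = bundle_proj P y\<^sub>1 \<and> bundle_proj P x\<^sub>2 = bundle_proj P y\<^sub>2 \<longrightarrow>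
        (fib_add P x\<^sub>1 y\<^sub>1, fib_add P x\<^sub>2 y\<^sub>2) \<in> rL) \<and>
     (\<forall>(x\<^sub>1, x\<^sub>2)\<in>rL. \<forall>r. (lsmul P r x\<^sub>1, lsmul P r x\<^sub>2) \<in> rL \<and> (rsmul P x\<^sub>1 r, rsmul P x\<^sub>2 r) \<in> rL) \<and>
     (\<forall>x\<in>arrows (total_space P). \<forall>y\<in>arrows (total_space P). (bundle_proj P x, bundle_proj P y) \<in> rG \<longrightarrow>
        (\<exists>y'\<in>arrows (total_space P). (y, y') \<in> rL \<and> bundle_proj P x = bundle_proj P y'))"

text \<open>As for semigroupoids, all choices of representatives in the unions yield the same class.\<close>

definition quotient_bundle ::
    "('r, 'l, 'w, 'g, 'v) bundle_data \<Rightarrow> 'g rel \<Rightarrow> 'l rel \<Rightarrow> ('r, 'l set, 'w, 'g set, 'v) bundle_data" where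
  "quotient_bundle P rG rL =
     \<lparr> total_space = quotient_semigroupoid (total_space P) rL,
       base_space = quotient_semigroupoid (base_space P) rG,
       bundle_proj = (\<lambda>X. \<Union>x\<in>X. rG `` {bundle_proj P x}),
       fib_add = (\<lambda>X Y. \<Union>(x, y')\<in>{(x, y'). x \<in> X \<and> y' \<in> Y \<and> bundle_proj P x = bundle_proj P y'}.
                    rL `` {fib_add P x y'}),
       fib_zero = (\<lambda>C. \<Union>\<gamma>\<in>C. rL `` {fib_zero P \<gamma>}),
       lsmul = (\<lambda>r X. \<Union>x\<in>X. rL `` {lsmul P r x}),
       rsmul = (\<lambda>X r. \<Union>x\<in>X. rL `` {rsmul P x r}) \<rparr>"

definition zero_set_saturated :: "('r, 'l, 'w, 'g, 'v) bundle_data \<Rightarrow> 'l rel \<Rightarrow> bool" where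
  "zero_set_saturated P rL \<longleftrightarrow>
     (\<forall>x\<in>arrows (total_space P). \<forall>\<gamma>\<in>arrows (base_space P).
        (x, fib_zero P \<gamma>) \<in> rL \<longrightarrow> x = fib_zero P (bundle_proj P x))"

definition quotient_hom ::
    "('r, 'l, 'w, 'g, 'v) bundle_data \<Rightarrow> 'g rel \<Rightarrow> 'l rel \<Rightarrow> ('g \<Rightarrow> 'l) \<Rightarrow> 'g set \<Rightarrow> 'l set" where
  "quotient_hom P rG rL \<alpha> =
     (\<lambda>C\<in>arrows (base_space P) // rG.
        fiber_sum (quotient_bundle P rG rL) C (\<lambda>\<gamma>. rL `` {\<alpha> \<gamma>}) C)"


section \<open>Conjugate sections\<close>

definition conjugating ::
    "('r, 'l, 'w, 'g, 'v) bundle_data \<Rightarrow> 'g rel \<Rightarrow> 'l rel \<Rightarrow> ('g \<Rightarrow> 'l) \<Rightarrow> 'g set \<Rightarrow> 'g set \<Rightarrow>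
      ('g \<Rightarrow> 'g) \<Rightarrow> 'l set \<Rightarrow> 'l set \<Rightarrow> ('l \<Rightarrow> 'l) \<Rightarrow> bool" where
  "conjugating P rG rL \<alpha> V W \<phi> A B \<psi> \<longleftrightarrow>
     (let L = arrow_top (total_space P); G = arrow_top (base_space P) in
        openin G V \<and> Hausdorff_space (subtopology G V) \<and> \<alpha> \<in> Cc P V \<and>
        openin G W \<and> homeomorphic_map (subtopology G W) (subtopology G V) \<phi> \<and>
        (\<forall>\<gamma>\<in>W. (\<gamma>, \<phi> \<gamma>) \<in> rG) \<and>
        openin L A \<and> openin L B \<and> \<alpha> ` V \<subseteq> A \<and>
        homeomorphic_map (subtopology L A) (subtopology L B) \<psi> \<and>
        (\<forall>x\<in>A. (x, \<psi> x) \<in> rL) \<and>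
        (\<forall>\<gamma>\<in>W. bundle_proj P (\<psi> (\<alpha> (\<phi> \<gamma>))) = \<gamma>))"

definition conjugate_section ::
    "('r, 'l, 'w, 'g, 'v) bundle_data \<Rightarrow> 'g set \<Rightarrow> ('l \<Rightarrow> 'l) \<Rightarrow> ('g \<Rightarrow> 'l) \<Rightarrow> ('g \<Rightarrow> 'g) \<Rightarrow> 'g \<Rightarrow> 'l" where
  "conjugate_section P W \<psi> \<alpha> \<phi> =
     (\<lambda>\<gamma>\<in>arrows (base_space P). if \<gamma> \<in> W then \<psi> (\<alpha> (\<phi> \<gamma>)) else fib_zero P \<gamma>)"

definition conjugate_differences ::
    "('r, 'l, 'w, 'g, 'v) bundle_data \<Rightarrow> 'g rel \<Rightarrow> 'l rel \<Rightarrow> ('g \<Rightarrow> 'l) set" where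
  "conjugate_differences P rG rL =
     {section_diff P \<alpha> (conjugate_section P W \<psi> \<alpha> \<phi>) | \<alpha> V W \<phi> A B \<psi>.
        conjugating P rG rL \<alpha> V W \<phi> A B \<psi>}"

end

theory Submission
  imports Defs "HOL-Algebra.Product_Groups"
begin

text \<open>
  Write \<open>s\<close> for the source map of \<open>\<Gamma>\<close> and \<open>\<langle>K\<rangle>\<close> for the group generated by the differences
  \<open>\<alpha> - \<psi>\<alpha>\<phi>\<close>. Saturation of the zero set implies that distinct points of one fiber of \<open>\<pi>\<close> are never
  equivalent, so that the fiber over any \<open>\<gamma>\<close> is carried isomorphically onto the fiber of the quotient
  bundle over the class of \<open>\<gamma>\<close>. All elements of a class have the same source, and a section in the
  sectional algebra is nonzero at only finitely many points of each source fiber; hence \<open>T\<close> is a finite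
  sum over each class and is additive. Conjugation only permutes the terms of these sums, so \<open>\<langle>K\<rangle>\<close> lies
  in the kernel (\<open>T_conjugate_section\<close>).

  The converse is local over the vertex space. Functions on the vertices with values in \<open>R\<close> multiply
  sections through \<open>s\<close>. Call a section negligible at a vertex \<open>v\<close> if its multiples by all functions with
  compact support near \<open>v\<close> lie in \<open>\<langle>K\<rangle>\<close>. If every element of the kernel is negligible at every vertex,
  a partition of unity, built from local \<open>R\<close>-normality, shows that it lies in \<open>\<langle>K\<rangle>\<close>.

  To see that an element \<open>\<alpha>\<close> of the kernel is negligible at \<open>v\<close>, decompose it near \<open>v\<close> into
  sections, each supported on one open sheet on which \<open>s\<close> is injective. Two such summands whose sheets
  pass over \<open>v\<close> at equivalent points can be merged modulo negligible sections, by conjugating one of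
  them onto the sheet of the other (\<open>move_single_sheeted\<close>). What remains is a sum of sections on
  sheets that pass over \<open>v\<close> at pairwise inequivalent points \<open>\<gamma>\<close>
  (\<open>sectional_carrier_reducible\<close>). On the class of such a \<open>\<gamma>\<close> only one summand is nonzero,
  and \<open>T \<alpha> = 0\<close> forces its value at \<open>\<gamma>\<close> to be zero. As \<open>\<pi>\<close> is a local homeomorphism, the summand then
  vanishes near \<open>\<gamma>\<close>, and so it is negligible (\<open>reduced_negligible\<close>). The sheets of inequivalent
  points may well contain equivalent points arbitrarily close to \<open>v\<close>, since \<open>\<Gamma>/\<sim>\<close> need not be
  Hausdorff; it is this vanishing near \<open>\<gamma>\<close> that makes them harmless.
\<close>

section \<open>Open maps and open equivalence relations\<close>

lemma local_homeomorphism_imp_open_map: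
  assumes "local_homeomorphism X Y f"
  shows "open_map X Y f"
  unfolding open_map_def
proof (intro allI impI)
  fix U assume U: "openin X U"
  show "openin Y (f ` U)"
  proof (subst openin_subopen, intro ballI)
    fix y assume "y \<in> f ` U"
    then obtain x where x: "x \<in> U" "y = f x" by auto
    then obtain A where A: "openin X A" "x \<in> A" "openin Y (f ` A)"
        "homeomorphic_map (subtopology X A) (subtopology Y (f ` A)) f"
      using assms openin_subset[OF U] unfolding local_homeomorphism_def by (meson subsetD)
    have "openin (subtopology X A) (U \<inter> A)"
      using U by (auto simp: openin_subtopology)
    then have "openin (subtopology Y (f ` A)) (f ` (U \<inter> A))"
      using homeomorphic_imp_open_map[OF A(4)] by (simp add: open_map_def)
    then have "openin Y (f ` (U \<inter> A))"
      using A(3) openin_trans_full by blast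
    then show "\<exists>T. openin Y T \<and> y \<in> T \<and> T \<subseteq> f ` U"
      using x A(2) by blast
  qed
qed

lemma local_homeomorphism_locally_inj:
  assumes "local_homeomorphism X Y f" "x \<in> topspace X"
  obtains U where "openin X U" "x \<in> U" "inj_on f U"
proof -
  obtain U where U: "openin X U" "x \<in> U"
      "homeomorphic_map (subtopology X U) (subtopology Y (f ` U)) f"
    using assms unfolding local_homeomorphism_def by meson
  have "inj_on f U"
    using homeomorphic_imp_injective_map[OF U(3)] openin_subset[OF U(1)]
    by (simp add: Int_absorb1)
  then show thesis using that[OF U(1,2)] by simp
qed

lemma open_map_inj_on_imp_homeomorphic_map:
  assumes "continuous_map X Y f" "open_map X Y f" "openin X U" "inj_on f U"
  shows "homeomorphic_map (subtopology X U) (subtopology Y (f ` U)) f"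
proof (rule bijective_open_imp_homeomorphic_map)
  have sub: "U \<subseteq> topspace X" "f ` U \<subseteq> topspace Y"
    using assms(2,3) openin_subset[OF assms(3)] openin_subset[of Y "f ` U"]
    by (auto simp: open_map_def)
  show "continuous_map (subtopology X U) (subtopology Y (f ` U)) f"
    using assms(1) by (auto simp: continuous_map_in_subtopology continuous_map_from_subtopology)
  show "open_map (subtopology X U) (subtopology Y (f ` U)) f"
    using assms(2,3) by (intro open_map_into_subtopology open_map_from_subtopology) auto
  show "f ` topspace (subtopology X U) = topspace (subtopology Y (f ` U))"
    using sub by auto
  show "inj_on f (topspace (subtopology X U))"
    using assms(4) by (auto intro: inj_on_subset)
qed

text \<open>All the homeomorphisms needed for conjugation come from this lemma. The preimage of an open
  subset \<open>D\<close> of \<open>B\<close> under the map below is \<open>A \<inter> r `` D\<close>, which is open because saturations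
  are; the situation is symmetric in \<open>A\<close> and \<open>B\<close>.\<close>

lemma open_equivalence_transversals_homeomorphic:
  assumes r: "open_equivalence X r"
    and A: "openin X A" "\<And>x y. x \<in> A \<Longrightarrow> y \<in> A \<Longrightarrow> (x, y) \<in> r \<Longrightarrow> x = y" "A \<subseteq> r `` B"
    and B: "openin X B" "\<And>x y. x \<in> B \<Longrightarrow> y \<in> B \<Longrightarrow> (x, y) \<in> r \<Longrightarrow> x = y" "B \<subseteq> r `` A"
  obtains f where "homeomorphic_map (subtopology X A) (subtopology X B) f"
    "\<And>x. x \<in> A \<Longrightarrow> f x \<in> B \<and> (x, f x) \<in> r"
proof -
  have eq: "equiv (topspace X) r" and op: "\<And>U. openin X U \<Longrightarrow> openin X (r `` U)"
    using r by (auto simp: open_equivalence_def)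
  have sym: "(y, x) \<in> r" if "(x, y) \<in> r" for x y
    using eq that by (meson equivE symE)
  have trans: "(x, z) \<in> r" if "(x, y) \<in> r" "(y, z) \<in> r" for x y z
    using eq that by (meson equivE transE)
  \<comment> \<open>Choosing the related point is continuous in either direction.\<close>
  have cont: "continuous_map (subtopology X A) (subtopology X B) h"
    if "openin X A" "openin X B" and h: "\<And>x. x \<in> A \<Longrightarrow> h x \<in> B \<and> (x, h x) \<in> r"
      and u: "\<And>x y. x \<in> B \<Longrightarrow> y \<in> B \<Longrightarrow> (x, y) \<in> r \<Longrightarrow> x = y" for h A B
    unfolding continuous_map_def
  proof (intro conjI allI impI)
    have sub: "A \<subseteq> topspace X" "B \<subseteq> topspace X"
      using that by (simp_all add: openin_subset)
    then show "h \<in> topspace (subtopology X A) \<rightarrow> topspace (subtopology X B)"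
      using h by auto
    fix D assume D: "openin (subtopology X B) D"
    then have D': "openin X D" "D \<subseteq> B"
      using \<open>openin X B\<close> openin_open_subtopology by auto
    have "{x \<in> topspace (subtopology X A). h x \<in> D} = r `` D \<inter> A"
    proof (intro Set.set_eqI iffI)
      fix x assume "x \<in> {x \<in> topspace (subtopology X A). h x \<in> D}"
      then show "x \<in> r `` D \<inter> A" using h[of x] sym by auto
    next
      fix x assume "x \<in> r `` D \<inter> A"
      then obtain y where y: "y \<in> D" "(y, x) \<in> r" "x \<in> A" by auto
      then have "h x = y" using u[of y "h x"] h[of x] D' trans by blast
      then show "x \<in> {x \<in> topspace (subtopology X A). h x \<in> D}" using y sub by auto
    qed
    then show "openin (subtopology X A) {x \<in> topspace (subtopology X A). h x \<in> D}"
      using op[OF D'(1)] by (simp add: openin_subtopology_Int)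
  qed
  have "\<forall>x\<in>A. \<exists>y. y \<in> B \<and> (x, y) \<in> r" using A(3) sym by blast
  then obtain f where f: "\<And>x. x \<in> A \<Longrightarrow> f x \<in> B \<and> (x, f x) \<in> r" by metis
  have "\<forall>x\<in>B. \<exists>y. y \<in> A \<and> (x, y) \<in> r" using B(3) sym by blast
  then obtain g where g: "\<And>x. x \<in> B \<Longrightarrow> g x \<in> A \<and> (x, g x) \<in> r" by metis
  have "homeomorphic_maps (subtopology X A) (subtopology X B) f g"
    unfolding homeomorphic_maps_def
  proof (intro conjI ballI)
    show "continuous_map (subtopology X A) (subtopology X B) f"
      by (rule cont) (use A(1) B(1,2) f in auto)
    show "continuous_map (subtopology X B) (subtopology X A) g"
      by (rule cont) (use B(1) A(1,2) g in auto)
    show "g (f x) = x" if "x \<in> topspace (subtopology X A)" for x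
      using that f[of x] g[of "f x"] A(2)[of x "g (f x)"] trans by auto
    show "f (g y) = y" if "y \<in> topspace (subtopology X B)" for y
      using that g[of y] f[of "g y"] B(2)[of y "f (g y)"] trans by auto
  qed
  then show thesis using that f homeomorphic_maps_map by blast
qed

section \<open>Fibers\<close>

lemma fiber_group_simps [simp]:
  "carrier (fiber_group P \<gamma>) = fiber P \<gamma>" "monoid.mult (fiber_group P \<gamma>) = fib_add P"
  "one (fiber_group P \<gamma>) = fib_zero P \<gamma>"
  by (simp_all add: fiber_group_def)

locale saturated_bundle_congruence =
  fixes P :: "('r::{ring, topological_ab_group_add, topological_monoid_mult}, 'l, 'w, 'g, 'v) bundle_data"
    and rG :: "'g rel" and rL :: "'l rel"
  assumes continuous_bundle: "continuous_bundle P"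
    and etale_base: "etale (base_space P)"
    and base_locally_R_normal: "locally_R_normal TYPE('r) (arrow_top (base_space P))"
    and congruence: "bundle_congruence P rG rL"
    and proj_local_homeomorphism:
      "local_homeomorphism (arrow_top (total_space P)) (arrow_top (base_space P)) (bundle_proj P)"
    and saturated: "zero_set_saturated P rL"
begin

abbreviation "\<G> \<equiv> arrow_top (base_space P)"
abbreviation "\<L> \<equiv> arrow_top (total_space P)"
abbreviation "\<V> \<equiv> vertex_top (base_space P)"
abbreviation "\<Gamma> \<equiv> topspace \<G>"
abbreviation "\<Lambda> \<equiv> topspace \<L>"
abbreviation "s \<equiv> src (base_space P)"
abbreviation "\<pi> \<equiv> bundle_proj P"
abbreviation "zer \<equiv> fib_zero P"
abbreviation padd (infixl "+\<^sub>P" 65) where "x +\<^sub>P y \<equiv> fib_add P x y"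
abbreviation lmul (infixr "\<cdot>" 70) where "a \<cdot> x \<equiv> lsmul P a x"
abbreviation "Sec \<equiv> bundle_sections P"
abbreviation cls ("\<lbrakk>_\<rbrakk>") where "\<lbrakk>x\<rbrakk> \<equiv> rL `` {x}"

lemma R_bundle: "R_bundle P"
  using continuous_bundle by (simp add: continuous_bundle_def)

lemma continuous_map_proj: "continuous_map \<L> \<G> \<pi>"
  using continuous_bundle by (simp add: continuous_bundle_def Let_def)

lemma continuous_map_zero: "continuous_map \<G> \<L> zer"
  using continuous_bundle by (simp add: continuous_bundle_def Let_def)

lemma continuous_map_add:
  "continuous_map (subtopology (prod_topology \<L> \<L>) {(x, y). x \<in> \<Lambda> \<and> y \<in> \<Lambda> \<and> \<pi> x = \<pi> y}) \<L>
     (\<lambda>(x, y). x +\<^sub>P y)"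
  using continuous_bundle by (simp add: continuous_bundle_def Let_def)

lemma continuous_map_lsmul: "continuous_map (prod_topology euclidean \<L>) \<L> (\<lambda>(a, x). a \<cdot> x)"
  using continuous_bundle by (simp add: continuous_bundle_def Let_def)

lemma continuous_map_rsmul: "continuous_map (prod_topology \<L> euclidean) \<L> (\<lambda>(x, a). rsmul P x a)"
  using continuous_bundle by (simp add: continuous_bundle_def Let_def)

lemma proj_in: "x \<in> \<Lambda> \<Longrightarrow> \<pi> x \<in> \<Gamma>"
  using continuous_map_proj by (auto simp: continuous_map_def)

lemma mem_fiber: "x \<in> fiber P \<gamma> \<longleftrightarrow> x \<in> \<Lambda> \<and> \<pi> x = \<gamma>"
  by (simp add: fiber_def)

lemma bimodule_fiber: "\<gamma> \<in> \<Gamma> \<Longrightarrow> bimodule (fiber_group P \<gamma>) (lsmul P) (rsmul P)"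
  using R_bundle by (simp add: R_bundle_def)

lemma comm_group_fiber: "\<gamma> \<in> \<Gamma> \<Longrightarrow> comm_group (fiber_group P \<gamma>)"
  using bimodule_fiber by (simp add: bimodule_def)

lemma group_fiber: "\<gamma> \<in> \<Gamma> \<Longrightarrow> group (fiber_group P \<gamma>)"
  using comm_group_fiber comm_group_def by blast

context
  fixes \<gamma> assumes g: "\<gamma> \<in> \<Gamma>"
begin

interpretation F: comm_group "fiber_group P \<gamma>"
  by (rule comm_group_fiber[OF g])

lemma zero_in_fiber: "zer \<gamma> \<in> fiber P \<gamma>"
  using F.one_closed by simp

lemma add_in_fiber: "x \<in> fiber P \<gamma> \<Longrightarrow> y \<in> fiber P \<gamma> \<Longrightarrow> x +\<^sub>P y \<in> fiber P \<gamma>"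
  using F.m_closed by simp

lemma add_zero: "x \<in> fiber P \<gamma> \<Longrightarrow> x +\<^sub>P zer \<gamma> = x" "x \<in> fiber P \<gamma> \<Longrightarrow> zer \<gamma> +\<^sub>P x = x"
  using F.r_one F.l_one by simp_all

lemma smul_in_fiber: "x \<in> fiber P \<gamma> \<Longrightarrow> a \<cdot> x \<in> fiber P \<gamma>" "x \<in> fiber P \<gamma> \<Longrightarrow> rsmul P x a \<in> fiber P \<gamma>"
  using bimodule_fiber[OF g] by (simp_all add: bimodule_def)

lemma one_smul: "x \<in> fiber P \<gamma> \<Longrightarrow> 1 \<cdot> x = x"
  using bimodule_fiber[OF g] by (simp_all add: bimodule_def)

lemma smul_smul: "x \<in> fiber P \<gamma> \<Longrightarrow> a \<cdot> b \<cdot> x = (a * b) \<cdot> x"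
  using bimodule_fiber[OF g] by (simp_all add: bimodule_def)

lemma add_smul: "x \<in> fiber P \<gamma> \<Longrightarrow> (a + b) \<cdot> x = a \<cdot> x +\<^sub>P b \<cdot> x"
  using bimodule_fiber[OF g] by (simp_all add: bimodule_def)

lemma smul_add:
  "x \<in> fiber P \<gamma> \<Longrightarrow> y \<in> fiber P \<gamma> \<Longrightarrow> a \<cdot> (x +\<^sub>P y) = a \<cdot> x +\<^sub>P a \<cdot> y"
  "x \<in> fiber P \<gamma> \<Longrightarrow> y \<in> fiber P \<gamma> \<Longrightarrow> rsmul P (x +\<^sub>P y) a = rsmul P x a +\<^sub>P rsmul P y a"
  using bimodule_fiber[OF g] by (simp_all add: bimodule_def)

lemma zero_smul: "x \<in> fiber P \<gamma> \<Longrightarrow> 0 \<cdot> x = zer \<gamma>"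
  using add_smul[of x 0 0] F.r_cancel_one'[of "0 \<cdot> x" "0 \<cdot> x"] smul_in_fiber(1)[of x 0] by simp

lemma smul_zero: "a \<cdot> zer \<gamma> = zer \<gamma>" "rsmul P (zer \<gamma>) a = zer \<gamma>"
  using smul_add[of "zer \<gamma>" "zer \<gamma>" a] F.r_cancel_one'[of "a \<cdot> zer \<gamma>" "a \<cdot> zer \<gamma>"]
    F.r_cancel_one'[of "rsmul P (zer \<gamma>) a" "rsmul P (zer \<gamma>) a"]
    smul_in_fiber[of "zer \<gamma>" a] zero_in_fiber add_zero[of "zer \<gamma>"] by simp_all

lemma inv_fiber: "x \<in> fiber P \<gamma> \<Longrightarrow> inv\<^bsub>fiber_group P \<gamma>\<^esub> x = (- 1) \<cdot> x"
proof -
  assume x: "x \<in> fiber P \<gamma>"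
  have "(- 1) \<cdot> x +\<^sub>P x = zer \<gamma>"
    using add_smul[OF x, of "- 1" 1] one_smul[OF x] zero_smul[OF x] by simp
  then show ?thesis
    using F.inv_equality[of "(- 1) \<cdot> x" x] x smul_in_fiber(1)[OF x] by simp
qed

end

lemma zero_in [simp]: "\<gamma> \<in> \<Gamma> \<Longrightarrow> zer \<gamma> \<in> \<Lambda>" "\<gamma> \<in> \<Gamma> \<Longrightarrow> \<pi> (zer \<gamma>) = \<gamma>"
  using zero_in_fiber mem_fiber by auto

section \<open>Classes of a bundle congruence\<close>

lemma open_equivalence_rG: "open_equivalence \<G> rG"
  using congruence by (simp add: bundle_congruence_def open_rigid_congruence_def)

lemma open_equivalence_rL: "open_equivalence \<L> rL"
  using congruence by (simp add: bundle_congruence_def open_rigid_congruence_def)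

lemma equiv_rG: "equiv \<Gamma> rG"
  using open_equivalence_rG by (simp add: open_equivalence_def)

lemma equiv_rL: "equiv \<Lambda> rL"
  using open_equivalence_rL by (simp add: open_equivalence_def)

lemma rG_sym: "(x, y) \<in> rG \<Longrightarrow> (y, x) \<in> rG"
  using equiv_rG by (meson equivE symE)

lemma rG_trans: "(x, y) \<in> rG \<Longrightarrow> (y, z) \<in> rG \<Longrightarrow> (x, z) \<in> rG"
  using equiv_rG by (meson equivE transE)

lemma rL_sym: "(x, y) \<in> rL \<Longrightarrow> (y, x) \<in> rL"
  using equiv_rL by (meson equivE symE)

lemma rL_trans: "(x, y) \<in> rL \<Longrightarrow> (y, z) \<in> rL \<Longrightarrow> (x, z) \<in> rL"
  using equiv_rL by (meson equivE transE)

lemma rG_refl: "x \<in> \<Gamma> \<Longrightarrow> (x, x) \<in> rG"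
  using equiv_rG by (simp add: equiv_def refl_on_def)

lemma rL_refl: "x \<in> \<Lambda> \<Longrightarrow> (x, x) \<in> rL"
  using equiv_rL by (simp add: equiv_def refl_on_def)

lemma rG_in: "(x, y) \<in> rG \<Longrightarrow> x \<in> \<Gamma>" "(x, y) \<in> rG \<Longrightarrow> y \<in> \<Gamma>"
  using equiv_class_eq_iff[OF equiv_rG] by auto

lemma rL_in: "(x, y) \<in> rL \<Longrightarrow> x \<in> \<Lambda>" "(x, y) \<in> rL \<Longrightarrow> y \<in> \<Lambda>"
  using equiv_class_eq_iff[OF equiv_rL] by auto

lemma cls_eq_iff: "x \<in> \<Lambda> \<Longrightarrow> y \<in> \<Lambda> \<Longrightarrow> \<lbrakk>x\<rbrakk> = \<lbrakk>y\<rbrakk> \<longleftrightarrow> (x, y) \<in> rL"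
  using eq_equiv_class_iff[OF equiv_rL] by simp

lemma rG_src: "(x, y) \<in> rG \<Longrightarrow> s x = s y"
  using congruence by (auto simp: bundle_congruence_def open_rigid_congruence_def rigid_congruence_def)

lemma rL_proj: "(x, y) \<in> rL \<Longrightarrow> (\<pi> x, \<pi> y) \<in> rG"
  using congruence by (auto simp: bundle_congruence_def)

lemma rL_add:
  "(x, x') \<in> rL \<Longrightarrow> (y, y') \<in> rL \<Longrightarrow> \<pi> x = \<pi> y \<Longrightarrow> \<pi> x' = \<pi> y' \<Longrightarrow> (x +\<^sub>P y, x' +\<^sub>P y') \<in> rL"
  using congruence unfolding bundle_congruence_def by blast

lemma rL_smul: "(x, x') \<in> rL \<Longrightarrow> (a \<cdot> x, a \<cdot> x') \<in> rL"
  using congruence unfolding bundle_congruence_def by blast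

lemma rL_lift:
  assumes "y \<in> \<Lambda>" "(\<pi> y, \<gamma>) \<in> rG"
  obtains y' where "(y, y') \<in> rL" "\<pi> y' = \<gamma>"
proof -
  have g: "\<gamma> \<in> \<Gamma>" using assms rG_in by blast
  have "(\<pi> (zer \<gamma>), \<pi> y) \<in> rG" using assms(2) rG_sym g by simp
  then obtain y' where "(y, y') \<in> rL" "\<pi> (zer \<gamma>) = \<pi> y'"
    using congruence assms(1) zero_in(1)[OF g] unfolding bundle_congruence_def by blast
  then show thesis using that g by simp
qed

lemma rL_zero_saturated: "(x, zer \<gamma>) \<in> rL \<Longrightarrow> \<gamma> \<in> \<Gamma> \<Longrightarrow> x = zer (\<pi> x)"
  using saturated rL_in unfolding zero_set_saturated_def by blast

text \<open>Some point of the fiber over \<open>\<gamma>'\<close> is equivalent to the zero over \<open>\<gamma>\<close>. By saturation it is itself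
  a zero.\<close>

lemma rL_zero:
  assumes "(\<gamma>, \<gamma>') \<in> rG" shows "(zer \<gamma>, zer \<gamma>') \<in> rL"
proof -
  have g: "\<gamma> \<in> \<Gamma>" "\<gamma>' \<in> \<Gamma>" using assms rG_in by auto
  then obtain y' where y: "(zer \<gamma>, y') \<in> rL" "\<pi> y' = \<gamma>'"
    using rL_lift[of "zer \<gamma>" \<gamma>'] assms by auto
  then have "y' = zer \<gamma>'"
    using rL_zero_saturated[of y' \<gamma>] rL_sym g by blast
  then show ?thesis using y by simp
qed

text \<open>The difference of two equivalent points of one fiber is equivalent to zero, hence zero by
  saturation.\<close>

lemma rL_inj_on_fibers:
  assumes xy: "(x, y) \<in> rL" "\<pi> x = \<pi> y" shows "x = y"
proof -
  define \<gamma> where "\<gamma> = \<pi> x"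
  have mem: "x \<in> fiber P \<gamma>" "y \<in> fiber P \<gamma>" and g: "\<gamma> \<in> \<Gamma>"
    using rL_in xy proj_in by (auto simp: mem_fiber \<gamma>_def)
  interpret F: comm_group "fiber_group P \<gamma>" by (rule comm_group_fiber[OF g])
  let ?n = "inv\<^bsub>fiber_group P \<gamma>\<^esub> x"
  have n: "?n \<in> fiber P \<gamma>" using F.inv_closed mem(1) by simp
  then have "(x +\<^sub>P ?n, y +\<^sub>P ?n) \<in> rL"
    by (intro rL_add) (use xy mem in \<open>auto simp: mem_fiber rL_refl\<close>)
  moreover have "x +\<^sub>P ?n = zer \<gamma>" using F.r_inv mem(1) by simp
  ultimately have "y +\<^sub>P ?n = zer (\<pi> (y +\<^sub>P ?n))"
    using rL_zero_saturated[of "y +\<^sub>P ?n" \<gamma>] rL_sym g by simp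
  moreover have "\<pi> (y +\<^sub>P ?n) = \<gamma>" using add_in_fiber[OF g mem(2) n] by (simp add: mem_fiber)
  ultimately have "y +\<^sub>P ?n = zer \<gamma>" by simp
  then show ?thesis
    using F.inv_equality[of y ?n] F.inv_inv mem n by simp
qed

section \<open>Fibers of the quotient bundle\<close>

abbreviation "Q \<equiv> quotient_bundle P rG rL"

lemma arrows_Q: "arrows (base_space Q) = \<Gamma> // rG" "arrows (total_space Q) = \<Lambda> // rL"
  by (simp_all add: quotient_bundle_def quotient_semigroupoid_def
      topspace_quotient_topology[OF equiv_rG] topspace_quotient_topology[OF equiv_rL])

lemma class_memD: "C \<in> \<Gamma> // rG \<Longrightarrow> \<gamma> \<in> C \<Longrightarrow> \<gamma> \<in> \<Gamma>"
  using equiv_rG in_quotient_imp_subset by blast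

lemma class_related: "C \<in> \<Gamma> // rG \<Longrightarrow> \<gamma> \<in> C \<Longrightarrow> \<gamma>' \<in> C \<Longrightarrow> (\<gamma>, \<gamma>') \<in> rG"
  using equiv_rG in_quotient_imp_in_rel[of \<Gamma> rG C \<gamma> \<gamma>'] by simp

lemma class_eq: "C \<in> \<Gamma> // rG \<Longrightarrow> \<gamma> \<in> C \<Longrightarrow> C = rG `` {\<gamma>}"
  using equiv_rG in_quotient_imp_closed[of \<Gamma> rG C \<gamma>] class_related by blast

lemma zero_Q: "C \<in> \<Gamma> // rG \<Longrightarrow> \<gamma> \<in> C \<Longrightarrow> fib_zero Q C = \<lbrakk>zer \<gamma>\<rbrakk>"
  unfolding quotient_bundle_def bundle_data.simps
proof (rule UN_constant_eq)
  assume C: "C \<in> \<Gamma> // rG" "\<gamma> \<in> C"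
  show "\<gamma> \<in> C" by fact
  show "\<forall>\<gamma>'\<in>C. \<lbrakk>zer \<gamma>'\<rbrakk> = \<lbrakk>zer \<gamma>\<rbrakk>"
    using class_related[OF C(1) _ C(2)] rL_zero equiv_class_eq[OF equiv_rL] by blast
qed

lemma proj_Q:
  assumes x: "x \<in> \<Lambda>" shows "bundle_proj Q \<lbrakk>x\<rbrakk> = rG `` {\<pi> x}"
  unfolding quotient_bundle_def bundle_data.simps
proof (rule UN_constant_eq)
  show "x \<in> \<lbrakk>x\<rbrakk>" using x rL_refl by simp
  show "\<forall>y\<in>\<lbrakk>x\<rbrakk>. rG `` {\<pi> y} = rG `` {\<pi> x}"
    using rL_proj equiv_class_eq[OF equiv_rG] by blast
qed

lemma add_Q:
  assumes x: "x \<in> fiber P \<gamma>" "y \<in> fiber P \<gamma>"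
  shows "fib_add Q \<lbrakk>x\<rbrakk> \<lbrakk>y\<rbrakk> = \<lbrakk>x +\<^sub>P y\<rbrakk>"
  unfolding quotient_bundle_def bundle_data.simps
proof (rule UN_constant_eq)
  show "(x, y) \<in> {(x', y'). x' \<in> \<lbrakk>x\<rbrakk> \<and> y' \<in> \<lbrakk>y\<rbrakk> \<and> \<pi> x' = \<pi> y'}"
    using x rL_refl by (auto simp: mem_fiber)
  have "\<lbrakk>x' +\<^sub>P y'\<rbrakk> = \<lbrakk>x +\<^sub>P y\<rbrakk>" if "x' \<in> \<lbrakk>x\<rbrakk>" "y' \<in> \<lbrakk>y\<rbrakk>" "\<pi> x' = \<pi> y'" for x' y'
    using that x rL_add[of x x' y y'] equiv_class_eq[OF equiv_rL] by (auto simp: mem_fiber)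
  then show "\<forall>z\<in>{(x', y'). x' \<in> \<lbrakk>x\<rbrakk> \<and> y' \<in> \<lbrakk>y\<rbrakk> \<and> \<pi> x' = \<pi> y'}.
      (case z of (x', y') \<Rightarrow> \<lbrakk>x' +\<^sub>P y'\<rbrakk>) = \<lbrakk>x +\<^sub>P y\<rbrakk>" by auto
qed

lemma fiber_Q:
  assumes C: "C \<in> \<Gamma> // rG" "\<gamma> \<in> C" shows "fiber Q C = cls ` fiber P \<gamma>"
proof (intro equalityI subsetI)
  fix X assume "X \<in> fiber Q C"
  then have X: "X \<in> \<Lambda> // rL" "bundle_proj Q X = C" by (auto simp: fiber_def arrows_Q)
  then obtain x where x: "x \<in> \<Lambda>" "X = \<lbrakk>x\<rbrakk>" by (auto elim: quotientE)
  then have "(\<pi> x, \<gamma>) \<in> rG" using X proj_Q C by auto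
  then obtain y where y: "(x, y) \<in> rL" "\<pi> y = \<gamma>" using rL_lift x by blast
  then have "X = \<lbrakk>y\<rbrakk>" "y \<in> fiber P \<gamma>"
    using x equiv_class_eq[OF equiv_rL] rL_in by (auto simp: mem_fiber)
  then show "X \<in> cls ` fiber P \<gamma>" by blast
next
  fix X assume "X \<in> cls ` fiber P \<gamma>"
  then obtain x where x: "x \<in> \<Lambda>" "\<pi> x = \<gamma>" "X = \<lbrakk>x\<rbrakk>" by (auto simp: mem_fiber)
  then show "X \<in> fiber Q C"
    using proj_Q class_eq[OF C] by (auto simp: fiber_def arrows_Q quotientI)
qed

text \<open>Condition (iii) of a bundle congruence gives surjectivity and saturation gives injectivity. The
  group structure of the quotient fibers is obtained by transport along this map.\<close>

lemma cls_iso: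
  assumes C: "C \<in> \<Gamma> // rG" "\<gamma> \<in> C" shows "cls \<in> iso (fiber_group P \<gamma>) (fiber_group Q C)"
  unfolding iso_def hom_def bij_betw_def
proof (intro CollectI conjI ballI)
  show "cls \<in> carrier (fiber_group P \<gamma>) \<rightarrow> carrier (fiber_group Q C)"
    using fiber_Q[OF C] by auto
  show "cls ` carrier (fiber_group P \<gamma>) = carrier (fiber_group Q C)"
    using fiber_Q[OF C] by simp
  show "\<lbrakk>x \<otimes>\<^bsub>fiber_group P \<gamma>\<^esub> y\<rbrakk> = \<lbrakk>x\<rbrakk> \<otimes>\<^bsub>fiber_group Q C\<^esub> \<lbrakk>y\<rbrakk>"
    if "x \<in> carrier (fiber_group P \<gamma>)" "y \<in> carrier (fiber_group P \<gamma>)" for x y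
    using that add_Q by simp
  show "inj_on cls (carrier (fiber_group P \<gamma>))"
    by (rule inj_onI) (auto simp: mem_fiber cls_eq_iff intro: rL_inj_on_fibers)
qed

lemma comm_group_fiber_Q:
  assumes C: "C \<in> \<Gamma> // rG" shows "comm_group (fiber_group Q C)"
proof -
  obtain \<gamma> where g: "\<gamma> \<in> C" "\<gamma> \<in> \<Gamma>"
    using C in_quotient_imp_non_empty[OF equiv_rG C] class_memD by blast
  have "comm_group ((fiber_group Q C)\<lparr>one := \<lbrakk>\<one>\<^bsub>fiber_group P \<gamma>\<^esub>\<rbrakk>\<rparr>)"
    by (rule comm_group.iso_imp_img_comm_group[OF comm_group_fiber[OF g(2)] cls_iso[OF C g(1)]])
  moreover have "(fiber_group Q C)\<lparr>one := \<lbrakk>\<one>\<^bsub>fiber_group P \<gamma>\<^esub>\<rbrakk>\<rparr> = fiber_group Q C"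
    using zero_Q[OF C g(1)] by (simp add: fiber_group_def)
  ultimately show ?thesis by simp
qed

section \<open>The group of sections\<close>

definition "sec_zero = (\<lambda>\<gamma>\<in>\<Gamma>. zer \<gamma>)"

definition "sec_group = product_group \<Gamma> (fiber_group P)"

lemma sec_group_simps [simp]:
  "carrier sec_group = Sec" "monoid.mult sec_group = section_add P" "one sec_group = sec_zero"
  by (auto simp: sec_group_def bundle_sections_def section_add_def sec_zero_def fun_eq_iff)

lemma sec_apply: "\<alpha> \<in> Sec \<Longrightarrow> \<gamma> \<in> \<Gamma> \<Longrightarrow> \<alpha> \<gamma> \<in> fiber P \<gamma>"
  by (auto simp: bundle_sections_def)

lemma sec_eqI: "\<alpha> \<in> Sec \<Longrightarrow> \<beta> \<in> Sec \<Longrightarrow> (\<And>\<gamma>. \<gamma> \<in> \<Gamma> \<Longrightarrow> \<alpha> \<gamma> = \<beta> \<gamma>) \<Longrightarrow> \<alpha> = \<beta>"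
  by (auto simp: bundle_sections_def intro: PiE_ext)

lemma sec_restrictI: "(\<And>\<gamma>. \<gamma> \<in> \<Gamma> \<Longrightarrow> f \<gamma> \<in> fiber P \<gamma>) \<Longrightarrow> (\<lambda>\<gamma>\<in>\<Gamma>. f \<gamma>) \<in> Sec"
  by (auto simp: bundle_sections_def)

lemma sec_add_apply [simp]: "\<gamma> \<in> \<Gamma> \<Longrightarrow> section_add P \<alpha> \<beta> \<gamma> = \<alpha> \<gamma> +\<^sub>P \<beta> \<gamma>"
  by (simp add: section_add_def)

lemma sec_zero_apply [simp]: "\<gamma> \<in> \<Gamma> \<Longrightarrow> sec_zero \<gamma> = zer \<gamma>"
  by (simp add: sec_zero_def)

lemma comm_group_sec_group: "comm_group sec_group"
proof -
  interpret S: Group.group sec_group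
    unfolding sec_group_def by (rule product_group) (rule group_fiber)
  show ?thesis
  proof (rule S.group_comm_groupI)
    fix \<alpha> \<beta> assume ab: "\<alpha> \<in> carrier sec_group" "\<beta> \<in> carrier sec_group"
    then have "\<alpha> \<gamma> +\<^sub>P \<beta> \<gamma> = \<beta> \<gamma> +\<^sub>P \<alpha> \<gamma>" if "\<gamma> \<in> \<Gamma>" for \<gamma>
      using comm_monoid.m_comm[of "fiber_group P \<gamma>" "\<alpha> \<gamma>" "\<beta> \<gamma>"] sec_apply that
        comm_group_fiber[OF that] by (simp add: comm_group_def)
    then show "\<alpha> \<otimes>\<^bsub>sec_group\<^esub> \<beta> = \<beta> \<otimes>\<^bsub>sec_group\<^esub> \<alpha>"
      by (auto simp: section_add_def)
  qed
qed

sublocale S: comm_group sec_group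
  rewrites "carrier sec_group = Sec" and "monoid.mult sec_group = section_add P"
    and "one sec_group = sec_zero"
  using comm_group_sec_group by simp_all

lemma inv_sec_group: "\<alpha> \<in> Sec \<Longrightarrow> inv\<^bsub>sec_group\<^esub> \<alpha> = section_lsmul P (- 1) \<alpha>"
  using inv_product_group[of \<alpha> \<Gamma> "fiber_group P"] sec_apply
  by (auto simp: sec_group_def bundle_sections_def group_fiber section_lsmul_def inv_fiber intro!: restrict_ext)

lemma section_diff_eq:
  assumes "\<alpha> \<in> Sec" "\<beta> \<in> Sec" shows "section_diff P \<alpha> \<beta> = section_add P \<alpha> (inv\<^bsub>sec_group\<^esub> \<beta>)"
  using assms sec_apply
  by (auto simp: inv_sec_group section_diff_def section_add_def section_lsmul_def inv_fiber intro!: restrict_ext)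

lemma section_diff_apply:
  "\<beta> \<in> Sec \<Longrightarrow> \<gamma> \<in> \<Gamma> \<Longrightarrow> section_diff P \<alpha> \<beta> \<gamma> = \<alpha> \<gamma> +\<^sub>P (- 1) \<cdot> \<beta> \<gamma>"
  using sec_apply by (simp add: section_diff_def inv_fiber)

lemma section_diff_in: "\<alpha> \<in> Sec \<Longrightarrow> \<beta> \<in> Sec \<Longrightarrow> section_diff P \<alpha> \<beta> \<in> Sec"
  by (simp add: section_diff_eq)

lemma section_diff_add: "\<alpha> \<in> Sec \<Longrightarrow> \<beta> \<in> Sec \<Longrightarrow> section_add P (section_diff P \<alpha> \<beta>) \<beta> = \<alpha>"
  by (simp add: section_diff_eq S.m_assoc)

section \<open>Summation over classes\<close>

abbreviation "T \<equiv> quotient_hom P rG rL"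

abbreviation "supp_on C \<alpha> \<equiv> {\<gamma> \<in> C. \<alpha> \<gamma> \<noteq> zer \<gamma>}"

lemma cls_sec: "C \<in> \<Gamma> // rG \<Longrightarrow> \<alpha> \<in> Sec \<Longrightarrow> \<gamma> \<in> C \<Longrightarrow> \<lbrakk>\<alpha> \<gamma>\<rbrakk> \<in> fiber Q C"
  using fiber_Q sec_apply class_memD by blast

lemma cls_eq_zero_iff:
  assumes C: "C \<in> \<Gamma> // rG" "\<gamma> \<in> C" and x: "x \<in> fiber P \<gamma>"
  shows "\<lbrakk>x\<rbrakk> = fib_zero Q C \<longleftrightarrow> x = zer \<gamma>"
  using assms zero_Q[OF C] zero_in_fiber[OF class_memD[OF C]] cls_iso[OF C]
  by (auto simp: iso_def bij_betw_def inj_on_def)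

lemma T_eq_finprod:
  assumes C: "C \<in> \<Gamma> // rG" and a: "\<alpha> \<in> Sec" and J: "finite J" "supp_on C \<alpha> \<subseteq> J" "J \<subseteq> C"
  shows "T \<alpha> C = finprod (fiber_group Q C) (\<lambda>\<gamma>. \<lbrakk>\<alpha> \<gamma>\<rbrakk>) J"
proof -
  interpret F: comm_group "fiber_group Q C" by (rule comm_group_fiber_Q[OF C])
  have z: "\<lbrakk>\<alpha> \<gamma>\<rbrakk> = fib_zero Q C \<longleftrightarrow> \<alpha> \<gamma> = zer \<gamma>" if "\<gamma> \<in> C" for \<gamma>
    using cls_eq_zero_iff[OF C that] sec_apply[OF a class_memD[OF C that]] .
  have "T \<alpha> C = finprod (fiber_group Q C) (\<lambda>\<gamma>. \<lbrakk>\<alpha> \<gamma>\<rbrakk>) {\<gamma> \<in> C. \<lbrakk>\<alpha> \<gamma>\<rbrakk> \<noteq> fib_zero Q C}"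
    using C by (simp add: quotient_hom_def fiber_sum_def)
  also have "\<dots> = finprod (fiber_group Q C) (\<lambda>\<gamma>. \<lbrakk>\<alpha> \<gamma>\<rbrakk>) J"
  proof (rule F.finprod_mono_neutral_cong_left)
    show "{\<gamma> \<in> C. \<lbrakk>\<alpha> \<gamma>\<rbrakk> \<noteq> fib_zero Q C} \<subseteq> J" using J(2) z by auto
    show "\<lbrakk>\<alpha> i\<rbrakk> = \<one>\<^bsub>fiber_group Q C\<^esub>" if "i \<in> J - {\<gamma> \<in> C. \<lbrakk>\<alpha> \<gamma>\<rbrakk> \<noteq> fib_zero Q C}" for i
      using that J by auto
    show "(\<lambda>\<gamma>. \<lbrakk>\<alpha> \<gamma>\<rbrakk>) \<in> J \<rightarrow> carrier (fiber_group Q C)"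
      using J(3) cls_sec[OF C a] by auto
  qed (use J in auto)
  finally show ?thesis .
qed

lemma T_in_fiber:
  assumes C: "C \<in> \<Gamma> // rG" and a: "\<alpha> \<in> Sec" "finite (supp_on C \<alpha>)"
  shows "T \<alpha> C \<in> fiber Q C"
proof -
  interpret F: comm_group "fiber_group Q C" by (rule comm_group_fiber_Q[OF C])
  have "finprod (fiber_group Q C) (\<lambda>\<gamma>. \<lbrakk>\<alpha> \<gamma>\<rbrakk>) (supp_on C \<alpha>) \<in> carrier (fiber_group Q C)"
    using cls_sec[OF C a(1)] by (intro F.finprod_closed) auto
  then show ?thesis using T_eq_finprod[OF C a] by simp
qed

lemma supp_on_add:
  assumes "\<alpha> \<in> Sec" "\<beta> \<in> Sec" "C \<subseteq> \<Gamma>"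
  shows "supp_on C (section_add P \<alpha> \<beta>) \<subseteq> supp_on C \<alpha> \<union> supp_on C \<beta>"
proof
  fix \<gamma> assume g: "\<gamma> \<in> supp_on C (section_add P \<alpha> \<beta>)"
  then have "\<gamma> \<in> \<Gamma>" using assms by auto
  then show "\<gamma> \<in> supp_on C \<alpha> \<union> supp_on C \<beta>"
    using g add_zero[of \<gamma>] zero_in_fiber by auto
qed

lemma T_add:
  assumes C: "C \<in> \<Gamma> // rG" and a: "\<alpha> \<in> Sec" "finite (supp_on C \<alpha>)"
    and b: "\<beta> \<in> Sec" "finite (supp_on C \<beta>)"
  shows "T (section_add P \<alpha> \<beta>) C = T \<alpha> C \<otimes>\<^bsub>fiber_group Q C\<^esub> T \<beta> C"
proof -
  interpret F: comm_group "fiber_group Q C" by (rule comm_group_fiber_Q[OF C])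
  let ?J = "supp_on C \<alpha> \<union> supp_on C \<beta>"
  have sub: "C \<subseteq> \<Gamma>" using class_memD[OF C] by blast
  have J: "finite ?J" "?J \<subseteq> C" using a b by auto
  have hom: "\<lbrakk>section_add P \<alpha> \<beta> \<gamma>\<rbrakk> = \<lbrakk>\<alpha> \<gamma>\<rbrakk> \<otimes>\<^bsub>fiber_group Q C\<^esub> \<lbrakk>\<beta> \<gamma>\<rbrakk>" if "\<gamma> \<in> C" for \<gamma>
    using add_Q[of "\<alpha> \<gamma>" \<gamma> "\<beta> \<gamma>"] sec_apply a b class_memD[OF C that] by simp
  have "T (section_add P \<alpha> \<beta>) C
      = finprod (fiber_group Q C) (\<lambda>\<gamma>. \<lbrakk>section_add P \<alpha> \<beta> \<gamma>\<rbrakk>) ?J"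
    by (rule T_eq_finprod[OF C]) (use a b J supp_on_add[OF a(1) b(1) sub] in auto)
  also have "\<dots> = finprod (fiber_group Q C) (\<lambda>\<gamma>. \<lbrakk>\<alpha> \<gamma>\<rbrakk> \<otimes>\<^bsub>fiber_group Q C\<^esub> \<lbrakk>\<beta> \<gamma>\<rbrakk>) ?J"
  proof (rule F.finprod_cong')
    show "(\<lambda>\<gamma>. \<lbrakk>\<alpha> \<gamma>\<rbrakk> \<otimes>\<^bsub>fiber_group Q C\<^esub> \<lbrakk>\<beta> \<gamma>\<rbrakk>) \<in> ?J \<rightarrow> carrier (fiber_group Q C)"
      using cls_sec[OF C a(1)] cls_sec[OF C b(1)] by (intro funcsetI F.m_closed) auto
  qed (use hom in auto)
  also have "\<dots> = finprod (fiber_group Q C) (\<lambda>\<gamma>. \<lbrakk>\<alpha> \<gamma>\<rbrakk>) ?J \<otimes>\<^bsub>fiber_group Q C\<^esub>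
      finprod (fiber_group Q C) (\<lambda>\<gamma>. \<lbrakk>\<beta> \<gamma>\<rbrakk>) ?J"
    using cls_sec[OF C a(1)] cls_sec[OF C b(1)] by (intro F.finprod_multf) auto
  also have "\<dots> = T \<alpha> C \<otimes>\<^bsub>fiber_group Q C\<^esub> T \<beta> C"
    using T_eq_finprod[OF C a(1) J(1) _ J(2)] T_eq_finprod[OF C b(1) J(1) _ J(2)] by simp
  finally show ?thesis .
qed

lemma T_cong:
  assumes C: "C \<in> \<Gamma> // rG" and ab: "\<alpha> \<in> Sec" "\<beta> \<in> Sec" and eq: "\<And>\<gamma>. \<gamma> \<in> C \<Longrightarrow> \<alpha> \<gamma> = \<beta> \<gamma>"
  shows "T \<alpha> C = T \<beta> C"
proof -
  interpret F: comm_group "fiber_group Q C" by (rule comm_group_fiber_Q[OF C])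
  have "finprod (fiber_group Q C) (\<lambda>\<gamma>. \<lbrakk>\<alpha> \<gamma>\<rbrakk>) {\<gamma> \<in> C. \<lbrakk>\<alpha> \<gamma>\<rbrakk> \<noteq> fib_zero Q C}
      = finprod (fiber_group Q C) (\<lambda>\<gamma>. \<lbrakk>\<beta> \<gamma>\<rbrakk>) {\<gamma> \<in> C. \<lbrakk>\<beta> \<gamma>\<rbrakk> \<noteq> fib_zero Q C}"
    by (rule F.finprod_cong') (use eq cls_sec[OF C ab(2)] in \<open>auto simp:\<close>)
  then show ?thesis
    using C by (simp add: quotient_hom_def fiber_sum_def)
qed

section \<open>Source fibers\<close>

lemma continuous_map_src: "continuous_map \<G> \<V> s"
  using etale_base by (simp add: etale_def topological_semigroupoid_def)

lemma src_in: "\<gamma> \<in> \<Gamma> \<Longrightarrow> s \<gamma> \<in> topspace \<V>"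
  using continuous_map_src by (auto simp: continuous_map_def)

lemma Hausdorff_vertices: "Hausdorff_space \<V>"
  using etale_base by (simp add: etale_def)

lemma open_map_src: "open_map \<G> \<V> s"
  using etale_base local_homeomorphism_imp_open_map by (auto simp: etale_def)

lemma src_locally_inj:
  assumes "openin \<G> V" "\<gamma> \<in> V"
  obtains U where "openin \<G> U" "\<gamma> \<in> U" "U \<subseteq> V" "inj_on s U"
proof -
  have "local_homeomorphism \<G> \<V> s" "\<gamma> \<in> \<Gamma>"
    using etale_base assms openin_subset by (auto simp: etale_def)
  then obtain U where "openin \<G> U" "\<gamma> \<in> U" "inj_on s U"
    using local_homeomorphism_locally_inj by metis
  then show thesis
    using that[of "U \<inter> V"] assms by (auto intro: inj_on_subset)
qed

text \<open>Source fibers are discrete. As classes lie in source fibers, this makes the sums defining \<open>T\<close>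
  finite.\<close>

lemma compactin_finite_src_fiber:
  assumes K: "compactin \<G> K" shows "finite {\<gamma> \<in> K. s \<gamma> = v}"
proof -
  let ?\<U> = "{U. openin \<G> U \<and> inj_on s U}"
  have "K \<subseteq> \<Gamma>" using K compactin_subset_topspace by blast
  then have "K \<subseteq> \<Union>?\<U>"
    using src_locally_inj[OF openin_topspace] by (smt (verit) UnionI mem_Collect_eq subset_iff)
  then obtain \<F> where F: "finite \<F>" "\<F> \<subseteq> ?\<U>" "K \<subseteq> \<Union>\<F>"
    using compactinD[OF K, of ?\<U>] by auto
  have "finite {\<gamma> \<in> U. s \<gamma> = v}" if "U \<in> \<F>" for U
  proof -
    have "inj_on s U" using that F by auto
    then have "{\<gamma> \<in> U. s \<gamma> = v} \<subseteq> {the_inv_into U s v}"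
      by (auto simp: the_inv_into_f_f)
    then show ?thesis using finite_subset by blast
  qed
  then have "finite (\<Union>U\<in>\<F>. {\<gamma> \<in> U. s \<gamma> = v})" using F(1) by blast
  then show ?thesis
    by (rule rev_finite_subset) (use F(3) in auto)
qed

section \<open>Continuous sections with compact support\<close>

abbreviation "cont_on U \<alpha> \<equiv> continuous_map (subtopology \<G> U) \<L> \<alpha>"

text \<open>Closures in \<open>\<G>\<close> are delicate because the space need not be Hausdorff. Inside a Hausdorff open set,
  a compact set outside which the section vanishes is closed and contains that part of the support.\<close>

lemma Cc_iff:
  assumes V: "openin \<G> V" "Hausdorff_space (subtopology \<G> V)"
  shows "\<alpha> \<in> Cc P V \<longleftrightarrow> \<alpha> \<in> Sec \<and> cont_on V \<alpha> \<and>
    (\<exists>K. compactin \<G> K \<and> K \<subseteq> V \<and> (\<forall>\<gamma>\<in>\<Gamma> - K. \<alpha> \<gamma> = zer \<gamma>))"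
proof (intro iffI conjI)
  assume a: "\<alpha> \<in> Cc P V"
  then show "\<alpha> \<in> Sec" "cont_on V \<alpha>" by (simp_all add: Cc_def)
  have "\<alpha> \<gamma> = zer \<gamma>" if "\<gamma> \<in> \<Gamma> - section_supp P \<alpha> \<inter> V" for \<gamma>
  proof (cases "\<gamma> \<in> V")
    case True
    have "{\<gamma> \<in> \<Gamma>. \<alpha> \<gamma> \<noteq> zer \<gamma>} \<subseteq> section_supp P \<alpha>"
      unfolding section_supp_def by (rule closure_of_subset) auto
    then show ?thesis using that True by auto
  next
    case False
    then show ?thesis using a that by (auto simp: Cc_def)
  qed
  moreover have "compactin \<G> (section_supp P \<alpha> \<inter> V)"
    using a by (simp add: Cc_def)
  ultimately show "\<exists>K. compactin \<G> K \<and> K \<subseteq> V \<and> (\<forall>\<gamma>\<in>\<Gamma> - K. \<alpha> \<gamma> = zer \<gamma>)"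
    by blast
next
  assume "\<alpha> \<in> Sec \<and> cont_on V \<alpha> \<and>
    (\<exists>K. compactin \<G> K \<and> K \<subseteq> V \<and> (\<forall>\<gamma>\<in>\<Gamma> - K. \<alpha> \<gamma> = zer \<gamma>))"
  then obtain K where a: "\<alpha> \<in> Sec" "cont_on V \<alpha>"
    and K: "compactin \<G> K" "K \<subseteq> V" "\<forall>\<gamma>\<in>\<Gamma> - K. \<alpha> \<gamma> = zer \<gamma>" by blast
  let ?S = "{\<gamma> \<in> \<Gamma>. \<alpha> \<gamma> \<noteq> zer \<gamma>}"
  have cK: "compactin (subtopology \<G> V) K"
    using K by (simp add: compactin_subtopology)
  then have "closedin (subtopology \<G> V) K"
    using V(2) compactin_imp_closedin by blast
  moreover have "?S \<subseteq> K" using K by auto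
  ultimately have "(subtopology \<G> V) closure_of ?S \<subseteq> K"
    by (rule closure_of_minimal[rotated])
  then have sub: "section_supp P \<alpha> \<inter> V \<subseteq> K"
    using closure_of_subtopology_open[of \<G> V ?S] V(1) K
    by (auto simp: section_supp_def)
  have "closedin (subtopology \<G> V) (section_supp P \<alpha> \<inter> V)"
    unfolding section_supp_def by (rule closedin_subtopology_Int_closed[THEN subst[of _ _ "closedin (subtopology \<G> V)", OF Int_commute]]) simp
  then have "compactin (subtopology \<G> V) (section_supp P \<alpha> \<inter> V)"
    using closed_compactin[OF cK sub] by blast
  then have "compactin \<G> (section_supp P \<alpha> \<inter> V)"
    by (simp add: compactin_subtopology)
  then show "\<alpha> \<in> Cc P V"
    using a K by (auto simp: Cc_def)
qed

lemma Cc_subset_Sec: "\<alpha> \<in> Cc P V \<Longrightarrow> \<alpha> \<in> Sec"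
  by (simp add: Cc_def)

lemma cont_on_subset: "cont_on U \<alpha> \<Longrightarrow> V \<subseteq> U \<Longrightarrow> cont_on V \<alpha>"
  using continuous_map_from_subtopology_mono by blast

lemma cont_on_cong:
  assumes "cont_on U \<alpha>" "\<And>\<gamma>. \<gamma> \<in> U \<Longrightarrow> \<gamma> \<in> \<Gamma> \<Longrightarrow> \<alpha> \<gamma> = \<beta> \<gamma>" shows "cont_on U \<beta>"
  by (rule continuous_map_eq[OF assms(1)]) (use assms(2) in auto)

lemma cont_on_add:
  assumes "\<alpha> \<in> Sec" "\<beta> \<in> Sec" "cont_on U \<alpha>" "cont_on U \<beta>"
  shows "cont_on U (section_add P \<alpha> \<beta>)"
proof -
  have "continuous_map (subtopology \<G> U)
      (subtopology (prod_topology \<L> \<L>) {(x, y). x \<in> \<Lambda> \<and> y \<in> \<Lambda> \<and> \<pi> x = \<pi> y}) (\<lambda>\<gamma>. (\<alpha> \<gamma>, \<beta> \<gamma>))"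
    using assms sec_apply by (auto simp: continuous_map_in_subtopology continuous_map_paired mem_fiber)
  from continuous_map_compose[OF this continuous_map_add]
  have "cont_on U (\<lambda>\<gamma>. \<alpha> \<gamma> +\<^sub>P \<beta> \<gamma>)" by (simp add: o_def)
  then show ?thesis by (rule cont_on_cong) simp
qed

text \<open>The action of functions on the vertex space; constant functions give scalar multiplication.\<close>

definition vertex_smul :: "('v \<Rightarrow> 'r) \<Rightarrow> ('g \<Rightarrow> 'l) \<Rightarrow> 'g \<Rightarrow> 'l" where
  "vertex_smul h \<alpha> = (\<lambda>\<gamma>\<in>\<Gamma>. h (s \<gamma>) \<cdot> \<alpha> \<gamma>)"

lemma vertex_smul_apply [simp]: "\<gamma> \<in> \<Gamma> \<Longrightarrow> vertex_smul h \<alpha> \<gamma> = h (s \<gamma>) \<cdot> \<alpha> \<gamma>"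
  by (simp add: vertex_smul_def)

lemma vertex_smul_in: "\<alpha> \<in> Sec \<Longrightarrow> vertex_smul h \<alpha> \<in> Sec"
  unfolding vertex_smul_def by (intro sec_restrictI smul_in_fiber sec_apply)

lemma vertex_smul_const: "section_lsmul P a = vertex_smul (\<lambda>_. a)"
  by (simp add: section_lsmul_def vertex_smul_def fun_eq_iff)

lemma section_lsmul_in: "\<alpha> \<in> Sec \<Longrightarrow> section_lsmul P a \<alpha> \<in> Sec"
  by (simp add: vertex_smul_const vertex_smul_in)

lemma section_rsmul_in: "\<alpha> \<in> Sec \<Longrightarrow> section_rsmul P \<alpha> a \<in> Sec"
  unfolding section_rsmul_def by (intro sec_restrictI smul_in_fiber sec_apply)

lemma vertex_smul_add:
  assumes "\<alpha> \<in> Sec" "\<beta> \<in> Sec"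
  shows "vertex_smul h (section_add P \<alpha> \<beta>) = section_add P (vertex_smul h \<alpha>) (vertex_smul h \<beta>)"
  by (rule sec_eqI) (use assms sec_apply in \<open>auto simp: vertex_smul_in smul_add\<close>)

lemma section_rsmul_add:
  assumes "\<alpha> \<in> Sec" "\<beta> \<in> Sec"
  shows "section_rsmul P (section_add P \<alpha> \<beta>) a = section_add P (section_rsmul P \<alpha> a) (section_rsmul P \<beta> a)"
  unfolding section_rsmul_def section_add_def
  by (rule restrict_ext) (use assms sec_apply in \<open>auto simp: smul_add\<close>)

lemma cont_on_vertex_smul:
  assumes h: "continuous_map \<V> euclidean h" and a: "\<alpha> \<in> Sec" "cont_on U \<alpha>"
  shows "cont_on U (vertex_smul h \<alpha>)"
proof -
  have "continuous_map (subtopology \<G> U) euclidean (h \<circ> s)"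
    by (intro continuous_map_compose[OF _ h] continuous_map_from_subtopology continuous_map_src)
  then have "continuous_map (subtopology \<G> U) (prod_topology euclidean \<L>) (\<lambda>\<gamma>. (h (s \<gamma>), \<alpha> \<gamma>))"
    using a by (simp add: continuous_map_paired o_def)
  from continuous_map_compose[OF this continuous_map_lsmul]
  have "cont_on U (\<lambda>\<gamma>. h (s \<gamma>) \<cdot> \<alpha> \<gamma>)" by (simp add: o_def)
  then show ?thesis by (rule cont_on_cong) simp
qed

lemma cont_on_rsmul:
  assumes a: "\<alpha> \<in> Sec" "cont_on U \<alpha>"
  shows "cont_on U (section_rsmul P \<alpha> c)"
proof -
  have "continuous_map (subtopology \<G> U) (prod_topology \<L> euclidean) (\<lambda>\<gamma>. (\<alpha> \<gamma>, c))"
    using a by (simp add: continuous_map_paired)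
  from continuous_map_compose[OF this continuous_map_rsmul]
  have "cont_on U (\<lambda>\<gamma>. rsmul P (\<alpha> \<gamma>) c)" by (simp add: o_def)
  then show ?thesis by (rule cont_on_cong) (simp add: section_rsmul_def)
qed

lemma Cc_vertex_smul:
  assumes V: "openin \<G> V" "Hausdorff_space (subtopology \<G> V)"
    and h: "continuous_map \<V> euclidean h" and a: "\<alpha> \<in> Cc P V"
  shows "vertex_smul h \<alpha> \<in> Cc P V"
proof -
  obtain K where K: "\<alpha> \<in> Sec" "cont_on V \<alpha>" "compactin \<G> K" "K \<subseteq> V" "\<forall>\<gamma>\<in>\<Gamma> - K. \<alpha> \<gamma> = zer \<gamma>"
    using a Cc_iff[OF V] by blast
  then have "\<forall>\<gamma>\<in>\<Gamma> - K. vertex_smul h \<alpha> \<gamma> = zer \<gamma>" using smul_zero by simp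
  then show ?thesis
    using K vertex_smul_in cont_on_vertex_smul[OF h] Cc_iff[OF V] by blast
qed

lemma Cc_rsmul:
  assumes V: "openin \<G> V" "Hausdorff_space (subtopology \<G> V)" and a: "\<alpha> \<in> Cc P V"
  shows "section_rsmul P \<alpha> c \<in> Cc P V"
proof -
  obtain K where K: "\<alpha> \<in> Sec" "cont_on V \<alpha>" "compactin \<G> K" "K \<subseteq> V" "\<forall>\<gamma>\<in>\<Gamma> - K. \<alpha> \<gamma> = zer \<gamma>"
    using a Cc_iff[OF V] by blast
  then have "\<forall>\<gamma>\<in>\<Gamma> - K. section_rsmul P \<alpha> c \<gamma> = zer \<gamma>"
    using smul_zero by (simp add: section_rsmul_def)
  then show ?thesis
    using K section_rsmul_in cont_on_rsmul Cc_iff[OF V] by blast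
qed

section \<open>The additive group of the sectional algebra\<close>

abbreviation "\<A> \<equiv> sectional_carrier P"

lemma sectional_carrier_subset_Sec: "\<alpha> \<in> \<A> \<Longrightarrow> \<alpha> \<in> Sec"
  by (induction rule: sectional_carrier.induct)
    (auto simp: Cc_subset_Sec section_lsmul_in section_rsmul_in)

text \<open>The sets \<open>Cc P V\<close> are closed under both scalar multiplications, so sums of their
  elements already form a bimodule.\<close>

lemma sectional_carrier_sum_induct [consumes 1, case_names Cc add]:
  assumes "\<alpha> \<in> \<A>"
    and "\<And>V \<alpha>. openin \<G> V \<Longrightarrow> Hausdorff_space (subtopology \<G> V) \<Longrightarrow> \<alpha> \<in> Cc P V \<Longrightarrow> R \<alpha>"
    and "\<And>\<alpha> \<beta>. \<alpha> \<in> \<A> \<Longrightarrow> \<beta> \<in> \<A> \<Longrightarrow> R \<alpha> \<Longrightarrow> R \<beta> \<Longrightarrow> R (section_add P \<alpha> \<beta>)"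
  shows "R \<alpha>"
  using assms
proof (induction arbitrary: R rule: sectional_carrier.induct)
  case (Cc V \<alpha>)
  then show ?case by blast
next
  case (add \<alpha> \<beta>)
  show ?case
  proof (rule add.prems(2)[OF add.hyps])
    show "R \<alpha>" by (rule add.IH(1)) (use add.prems in blast)+
    show "R \<beta>" by (rule add.IH(2)) (use add.prems in blast)+
  qed
next
  case (lsmul \<alpha> a)
  show ?case
  proof (rule lsmul.IH)
    show "R (section_lsmul P a \<alpha>)"
      if "openin \<G> V" "Hausdorff_space (subtopology \<G> V)" "\<alpha> \<in> Cc P V" for V \<alpha>
      using lsmul.prems(1)[OF that(1,2)] Cc_vertex_smul[OF that(1,2) _ that(3)]
      by (simp add: vertex_smul_const)
    show "R (section_lsmul P a (section_add P \<alpha> \<beta>))"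
      if "\<alpha> \<in> \<A>" "\<beta> \<in> \<A>" "R (section_lsmul P a \<alpha>)" "R (section_lsmul P a \<beta>)" for \<alpha> \<beta>
      using lsmul.prems(2)[OF sectional_carrier.lsmul[OF that(1)] sectional_carrier.lsmul[OF that(2)] that(3,4)]
        that sectional_carrier_subset_Sec
      by (simp add: vertex_smul_const vertex_smul_add)
  qed
next
  case (rsmul \<alpha> a)
  show ?case
  proof (rule rsmul.IH)
    show "R (section_rsmul P \<alpha> a)"
      if "openin \<G> V" "Hausdorff_space (subtopology \<G> V)" "\<alpha> \<in> Cc P V" for V \<alpha>
      using rsmul.prems(1)[OF that(1,2)] Cc_rsmul[OF that] by simp
    show "R (section_rsmul P (section_add P \<alpha> \<beta>) a)"
      if "\<alpha> \<in> \<A>" "\<beta> \<in> \<A>" "R (section_rsmul P \<alpha> a)" "R (section_rsmul P \<beta> a)" for \<alpha> \<beta>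
      using rsmul.prems(2)[OF sectional_carrier.rsmul[OF that(1)] sectional_carrier.rsmul[OF that(2)] that(3,4)]
        that sectional_carrier_subset_Sec
      by (simp add: section_rsmul_add)
  qed
qed

lemma sec_zero_in_sectional_carrier: "sec_zero \<in> \<A>"
proof (rule sectional_carrier.Cc)
  show "openin \<G> {}" "Hausdorff_space (subtopology \<G> {})"
    by (simp_all add: Hausdorff_space_def)
  then show "sec_zero \<in> Cc P {}"
    unfolding Cc_iff[OF \<open>openin \<G> {}\<close> \<open>Hausdorff_space (subtopology \<G> {})\<close>]
    using S.one_closed by (auto intro: exI[of _ "{}"] simp: continuous_map_def)
qed

lemma subgroup_sectional_carrier: "subgroup \<A> sec_group"
proof (rule S.subgroupI)
  show "\<A> \<subseteq> Sec" using sectional_carrier_subset_Sec by auto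
  show "\<A> \<noteq> {}" using sec_zero_in_sectional_carrier by blast
  show "inv\<^bsub>sec_group\<^esub> \<alpha> \<in> \<A>" if "\<alpha> \<in> \<A>" for \<alpha>
    using that sectional_carrier_subset_Sec by (simp add: inv_sec_group sectional_carrier.lsmul)
  show "section_add P \<alpha> \<beta> \<in> \<A>" if "\<alpha> \<in> \<A>" "\<beta> \<in> \<A>" for \<alpha> \<beta>
    using that by (simp add: sectional_carrier.add)
qed

lemma add_monoid_sectional_algebra:
  "add_monoid (sectional_algebra P) = sec_group\<lparr>carrier := \<A>\<rparr>"
  by (rule monoid.equality) (simp_all add: sectional_algebra_def sec_zero_def)

lemma finite_supp_src_fiber: "\<alpha> \<in> \<A> \<Longrightarrow> finite {\<gamma> \<in> \<Gamma>. s \<gamma> = v \<and> \<alpha> \<gamma> \<noteq> zer \<gamma>}"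
proof (induction rule: sectional_carrier_sum_induct)
  case (Cc V \<alpha>)
  then obtain K where K: "compactin \<G> K" "\<forall>\<gamma>\<in>\<Gamma> - K. \<alpha> \<gamma> = zer \<gamma>"
    using Cc_iff by metis
  show ?case
    by (rule finite_subset[OF _ compactin_finite_src_fiber[OF K(1), of v]]) (use K(2) in auto)
next
  case (add \<alpha> \<beta>)
  let ?C = "{\<gamma> \<in> \<Gamma>. s \<gamma> = v}"
  have "{\<gamma> \<in> \<Gamma>. s \<gamma> = v \<and> section_add P \<alpha> \<beta> \<gamma> \<noteq> zer \<gamma>}
      \<subseteq> {\<gamma> \<in> \<Gamma>. s \<gamma> = v \<and> \<alpha> \<gamma> \<noteq> zer \<gamma>} \<union> {\<gamma> \<in> \<Gamma>. s \<gamma> = v \<and> \<beta> \<gamma> \<noteq> zer \<gamma>}"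
    using supp_on_add[of \<alpha> \<beta> ?C] add.hyps sectional_carrier_subset_Sec by auto
  then show ?case using add.IH finite_subset by blast
qed

lemma finite_supp_class:
  assumes "\<alpha> \<in> \<A>" "C \<in> \<Gamma> // rG" shows "finite (supp_on C \<alpha>)"
proof (cases "C = {}")
  case False
  then obtain \<gamma>\<^sub>0 where g: "\<gamma>\<^sub>0 \<in> C" by blast
  show ?thesis
    by (rule finite_subset[OF _ finite_supp_src_fiber[OF assms(1), of "s \<gamma>\<^sub>0"]])
      (use rG_src[OF class_related[OF assms(2) _ g]] class_memD[OF assms(2)] in auto)
qed simp

section \<open>Conjugate sections have the same image\<close>

lemma conjugatingD:
  assumes "conjugating P rG rL \<alpha> V W \<phi> A B \<psi>"
  shows "openin \<G> V" "Hausdorff_space (subtopology \<G> V)" "\<alpha> \<in> Cc P V" "V \<subseteq> \<Gamma>"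
    "openin \<G> W" "W \<subseteq> \<Gamma>" "homeomorphic_map (subtopology \<G> W) (subtopology \<G> V) \<phi>"
    "\<And>\<gamma>. \<gamma> \<in> W \<Longrightarrow> (\<gamma>, \<phi> \<gamma>) \<in> rG" "openin \<L> A" "openin \<L> B" "\<alpha> ` V \<subseteq> A"
    "homeomorphic_map (subtopology \<L> A) (subtopology \<L> B) \<psi>"
    "\<And>x. x \<in> A \<Longrightarrow> (x, \<psi> x) \<in> rL" "\<And>\<gamma>. \<gamma> \<in> W \<Longrightarrow> \<pi> (\<psi> (\<alpha> (\<phi> \<gamma>))) = \<gamma>"
  using assms openin_subset[of \<G> V] openin_subset[of \<G> W] by (simp_all add: conjugating_def Let_def)

text \<open>By saturation \<open>\<psi>\<close> maps zeros to zeros and nonzero points to nonzero points, so the support of the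
  conjugate section in \<open>W\<close> is the preimage under \<open>\<phi>\<close> of the support of \<open>\<alpha>\<close> in \<open>V\<close>.\<close>

lemma conjugate_section_in_Cc:
  assumes c: "conjugating P rG rL \<alpha> V W \<phi> A B \<psi>"
  shows "openin \<G> W" "Hausdorff_space (subtopology \<G> W)" "conjugate_section P W \<psi> \<alpha> \<phi> \<in> Cc P W"
    "\<And>\<gamma>. \<gamma> \<in> W \<Longrightarrow> conjugate_section P W \<psi> \<alpha> \<phi> \<gamma> = zer \<gamma> \<longleftrightarrow> \<alpha> (\<phi> \<gamma>) = zer (\<phi> \<gamma>)"
proof -
  let ?\<beta> = "conjugate_section P W \<psi> \<alpha> \<phi>"
  note c' = conjugatingD[OF c]
  note V = c'(1-4) and W = c'(5,6) and hom = c'(7) and rel = c'(8) and AB = c'(9-12)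
    and rel' = c'(13) and sec = c'(14)
  show "openin \<G> W" by fact
  show H: "Hausdorff_space (subtopology \<G> W)"
    using homeomorphic_Hausdorff_space homeomorphic_map_imp_homeomorphic_space[OF hom] V(2) by blast
  have im: "\<phi> ` W = V"
    using homeomorphic_imp_surjective_map[OF hom] W V by (simp add: Int_absorb1)
  have phiV: "\<phi> \<gamma> \<in> V" "\<phi> \<gamma> \<in> \<Gamma>" "\<alpha> (\<phi> \<gamma>) \<in> A" if "\<gamma> \<in> W" for \<gamma>
    using that im V(4) AB(3) by auto
  have val: "?\<beta> \<gamma> = \<psi> (\<alpha> (\<phi> \<gamma>))" if "\<gamma> \<in> W" for \<gamma>
    using that W by (auto simp: conjugate_section_def)
  have bsec: "?\<beta> \<in> Sec"
    unfolding conjugate_section_def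
  proof (rule sec_restrictI)
    fix \<gamma> assume "\<gamma> \<in> \<Gamma>"
    then show "(if \<gamma> \<in> W then \<psi> (\<alpha> (\<phi> \<gamma>)) else zer \<gamma>) \<in> fiber P \<gamma>"
      using sec rL_in(2)[OF rel'[OF phiV(3)]] zero_in_fiber[of \<gamma>] by (auto simp: mem_fiber)
  qed
  show zero_iff: "?\<beta> \<gamma> = zer \<gamma> \<longleftrightarrow> \<alpha> (\<phi> \<gamma>) = zer (\<phi> \<gamma>)" if g: "\<gamma> \<in> W" for \<gamma>
  proof
    have r: "(\<alpha> (\<phi> \<gamma>), ?\<beta> \<gamma>) \<in> rL" using rel'[OF phiV(3)[OF g]] val[OF g] by simp
    have p: "\<pi> (\<alpha> (\<phi> \<gamma>)) = \<phi> \<gamma>"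
      using sec_apply[OF Cc_subset_Sec[OF V(3)] phiV(2)[OF g]] by (simp add: mem_fiber)
    show "\<alpha> (\<phi> \<gamma>) = zer (\<phi> \<gamma>)" if "?\<beta> \<gamma> = zer \<gamma>"
      using r that rL_zero_saturated[of "\<alpha> (\<phi> \<gamma>)" \<gamma>] g W p by auto
    show "?\<beta> \<gamma> = zer \<gamma>" if "\<alpha> (\<phi> \<gamma>) = zer (\<phi> \<gamma>)"
      using rL_sym[OF r] that rL_zero_saturated[of "?\<beta> \<gamma>" "\<phi> \<gamma>"] phiV[OF g] sec[OF g] val[OF g] by auto
  qed
  obtain K where K: "compactin \<G> K" "K \<subseteq> V" "\<forall>\<gamma>\<in>\<Gamma> - K. \<alpha> \<gamma> = zer \<gamma>" and acont: "cont_on V \<alpha>"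
    using V Cc_iff by blast
  let ?K = "{\<gamma> \<in> W. \<phi> \<gamma> \<in> K}"
  have "\<phi> ` ?K = K" using im K(2) by auto
  then have "compactin (subtopology \<G> V) (\<phi> ` ?K)"
    using K by (simp add: compactin_subtopology)
  then have "compactin (subtopology \<G> W) ?K"
    using homeomorphic_map_compactness[OF hom, of ?K] W by auto
  then have "compactin \<G> ?K" by (simp add: compactin_subtopology)
  moreover have "?\<beta> \<gamma> = zer \<gamma>" if "\<gamma> \<in> \<Gamma> - ?K" for \<gamma>
  proof (cases "\<gamma> \<in> W")
    case True
    then show ?thesis using that K(3) zero_iff phiV by blast
  qed (use that in \<open>simp add: conjugate_section_def\<close>)
  moreover have "cont_on W ?\<beta>"
  proof -
    have "continuous_map (subtopology \<G> W) (subtopology \<G> V) \<phi>"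
      using hom homeomorphic_imp_continuous_map by blast
    moreover have "continuous_map (subtopology \<G> V) (subtopology \<L> A) \<alpha>"
      using acont AB(3) by (auto simp: continuous_map_in_subtopology)
    moreover have "continuous_map (subtopology \<L> A) \<L> \<psi>"
      using homeomorphic_imp_continuous_map[OF AB(4)] by (simp add: continuous_map_in_subtopology)
    ultimately have "cont_on W (\<psi> \<circ> (\<alpha> \<circ> \<phi>))" by (intro continuous_map_compose)
    then show ?thesis by (rule cont_on_cong) (simp add: val)
  qed
  ultimately show "?\<beta> \<in> Cc P W"
    unfolding Cc_iff[OF W(1) H] using bsec by blast
qed

text \<open>Since \<open>\<phi>\<close> moves points within their classes, it maps \<open>C \<inter> W\<close> bijectively onto \<open>C \<inter> V\<close>, and \<open>\<psi>\<close>
  does not change the class of a value: the two sums have the same terms.\<close>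

lemma T_conjugate_section:
  assumes c: "conjugating P rG rL \<alpha> V W \<phi> A B \<psi>" and C: "C \<in> \<Gamma> // rG"
  shows "T (conjugate_section P W \<psi> \<alpha> \<phi>) C = T \<alpha> C"
proof -
  let ?\<beta> = "conjugate_section P W \<psi> \<alpha> \<phi>"
  note b = conjugate_section_in_Cc[OF c]
  note c' = conjugatingD[OF c]
  note V = c'(1-4) and W = c'(5,6) and hom = c'(7) and rel = c'(8) and A = c'(11)
    and rel' = c'(13)
  interpret F: comm_group "fiber_group Q C" by (rule comm_group_fiber_Q[OF C])
  have asec: "\<alpha> \<in> Sec" "?\<beta> \<in> Sec" using V b Cc_subset_Sec by auto
  have im: "\<phi> ` W = V"
    using homeomorphic_imp_surjective_map[OF hom] W V by (simp add: Int_absorb1)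
  have inj: "inj_on \<phi> W"
    using homeomorphic_imp_injective_map[OF hom] W by (simp add: Int_absorb1)
  let ?J = "supp_on C \<alpha>" let ?J' = "{\<gamma> \<in> W. \<phi> \<gamma> \<in> ?J}"
  have fin: "finite ?J" using finite_supp_class[OF _ C] sectional_carrier.Cc V by blast
  have zeroV: "\<alpha> \<gamma> = zer \<gamma>" if "\<gamma> \<in> C" "\<gamma> \<notin> V" for \<gamma>
    using V(3) that class_memD[OF C] by (auto simp: Cc_def)
  have JV: "?J \<subseteq> V" using zeroV by blast
  have im': "\<phi> ` ?J' = ?J" using im JV by auto
  have inj': "inj_on \<phi> ?J'" using inj by (rule inj_on_subset) auto
  have fin': "finite ?J'" using finite_imageD[of \<phi> ?J'] im' inj' fin by simp
  have inC: "\<gamma> \<in> C \<longleftrightarrow> \<phi> \<gamma> \<in> C" if "\<gamma> \<in> W" for \<gamma>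
    using rel[OF that] rG_sym class_eq[OF C] by blast
  have "T \<alpha> C = finprod (fiber_group Q C) (\<lambda>\<gamma>. \<lbrakk>\<alpha> \<gamma>\<rbrakk>) (\<phi> ` ?J')"
    using T_eq_finprod[OF C asec(1) fin] im' by simp
  also have "\<dots> = finprod (fiber_group Q C) (\<lambda>\<gamma>. \<lbrakk>\<alpha> (\<phi> \<gamma>)\<rbrakk>) ?J'"
    by (rule F.finprod_reindex) (use inj' im' cls_sec[OF C asec(1)] in \<open>auto simp:\<close>)
  also have "\<dots> = finprod (fiber_group Q C) (\<lambda>\<gamma>. \<lbrakk>?\<beta> \<gamma>\<rbrakk>) ?J'"
  proof (rule F.finprod_cong')
    show "(\<lambda>\<gamma>. \<lbrakk>?\<beta> \<gamma>\<rbrakk>) \<in> ?J' \<rightarrow> carrier (fiber_group Q C)"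
      using cls_sec[OF C asec(2)] inC by auto
    fix \<gamma> assume "\<gamma> \<in> ?J'"
    then have "(\<alpha> (\<phi> \<gamma>), ?\<beta> \<gamma>) \<in> rL"
      using rel'[of "\<alpha> (\<phi> \<gamma>)"] A im W by (auto simp: conjugate_section_def)
    then show "\<lbrakk>\<alpha> (\<phi> \<gamma>)\<rbrakk> = \<lbrakk>?\<beta> \<gamma>\<rbrakk>" using equiv_class_eq[OF equiv_rL] by blast
  qed simp
  also have "\<dots> = T ?\<beta> C"
  proof (rule T_eq_finprod[OF C asec(2) fin', symmetric])
    show "?J' \<subseteq> C" using inC by auto
    show "supp_on C ?\<beta> \<subseteq> ?J'"
    proof
      fix \<gamma> assume g: "\<gamma> \<in> supp_on C ?\<beta>"
      then have "\<gamma> \<in> W" using class_memD[OF C] by (auto simp: conjugate_section_def split: if_splits)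
      then show "\<gamma> \<in> ?J'" using g b(4) inC by auto
    qed
  qed
  finally show ?thesis by simp
qed

abbreviation "\<K> \<equiv> conjugate_differences P rG rL"

definition "kernel_T = {\<alpha> \<in> \<A>. \<forall>C\<in>\<Gamma> // rG. T \<alpha> C = fib_zero Q C}"

lemma a_kernel_eq:
  "a_kernel (sectional_algebra P) (sectional_algebra Q) T = kernel_T"
proof -
  have "T \<alpha> = (\<lambda>C\<in>\<Gamma> // rG. fib_zero Q C) \<longleftrightarrow> (\<forall>C\<in>\<Gamma> // rG. T \<alpha> C = fib_zero Q C)" for \<alpha>
    by (auto simp: quotient_hom_def fun_eq_iff)
  then show ?thesis
    by (simp add: a_kernel_def kernel_def sectional_algebra_def kernel_T_def arrows_Q)
qed

lemma conjugate_differences_subset: "\<K> \<subseteq> \<A>"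
proof
  fix \<delta> assume "\<delta> \<in> \<K>"
  then obtain \<alpha> V W \<phi> A B \<psi> where d: "\<delta> = section_diff P \<alpha> (conjugate_section P W \<psi> \<alpha> \<phi>)"
    and c: "conjugating P rG rL \<alpha> V W \<phi> A B \<psi>"
    unfolding conjugate_differences_def by blast
  then have "\<alpha> \<in> \<A>" unfolding conjugating_def Let_def by (blast intro: sectional_carrier.Cc)
  moreover have "conjugate_section P W \<psi> \<alpha> \<phi> \<in> \<A>"
    using conjugate_section_in_Cc[OF c] by (blast intro: sectional_carrier.Cc)
  ultimately show "\<delta> \<in> \<A>"
    using d subgroup.m_inv_closed[OF subgroup_sectional_carrier] sectional_carrier_subset_Sec
    by (simp add: section_diff_eq sectional_carrier.add)
qed

lemma generate_eq: "generate (add_monoid (sectional_algebra P)) \<K> = generate sec_group \<K>"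
  unfolding add_monoid_sectional_algebra
  by (rule S.generate_consistent[OF conjugate_differences_subset subgroup_sectional_carrier])

lemma conjugate_differences_subset_kernel: "\<K> \<subseteq> kernel_T"
proof
  fix \<delta> assume d: "\<delta> \<in> \<K>"
  then obtain \<alpha> V W \<phi> A B \<psi> where d': "\<delta> = section_diff P \<alpha> (conjugate_section P W \<psi> \<alpha> \<phi>)"
    and c: "conjugating P rG rL \<alpha> V W \<phi> A B \<psi>"
    unfolding conjugate_differences_def by blast
  let ?\<beta> = "conjugate_section P W \<psi> \<alpha> \<phi>"
  have a: "\<alpha> \<in> \<A>" using c unfolding conjugating_def Let_def by (blast intro: sectional_carrier.Cc)
  have b: "?\<beta> \<in> \<A>"
    using conjugate_section_in_Cc[OF c] by (blast intro: sectional_carrier.Cc)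
  have dA: "\<delta> \<in> \<A>" using d conjugate_differences_subset by blast
  have sum: "section_add P \<delta> ?\<beta> = \<alpha>"
    using section_diff_add a b d' sectional_carrier_subset_Sec by blast
  have "T \<delta> C = fib_zero Q C" if C: "C \<in> \<Gamma> // rG" for C
  proof -
    interpret F: comm_group "fiber_group Q C" by (rule comm_group_fiber_Q[OF C])
    note fin = finite_supp_class[OF _ C] and sec = sectional_carrier_subset_Sec
    have "T \<delta> C \<otimes>\<^bsub>fiber_group Q C\<^esub> T ?\<beta> C = T ?\<beta> C"
      using T_add[OF C sec[OF dA] fin[OF dA] sec[OF b] fin[OF b]] sum T_conjugate_section[OF c C] by simp
    then have "T \<delta> C = \<one>\<^bsub>fiber_group Q C\<^esub>"
      using T_in_fiber[OF C sec[OF dA] fin[OF dA]] T_in_fiber[OF C sec[OF b] fin[OF b]]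
      using F.r_cancel_one[of "T ?\<beta> C" "T \<delta> C"] by simp
    then show ?thesis by simp
  qed
  then show "\<delta> \<in> kernel_T" using dA by (simp add: kernel_T_def)
qed

lemma T_zero: "C \<in> \<Gamma> // rG \<Longrightarrow> T sec_zero C = fib_zero Q C"
  using T_eq_finprod[of C sec_zero "{}"] class_memD
    comm_monoid.finprod_empty[of "fiber_group Q C"] comm_group_fiber_Q[of C]
  by (simp add: comm_group_def)

lemma subgroup_kernel: "subgroup kernel_T sec_group"
proof (rule S.subgroupI)
  note fin = finite_supp_class and sec = sectional_carrier_subset_Sec
  show "kernel_T \<subseteq> Sec" using sec by (auto simp: kernel_T_def)
  show "kernel_T \<noteq> {}"
    using T_zero sec_zero_in_sectional_carrier by (auto simp: kernel_T_def)
  show "section_add P \<alpha> \<beta> \<in> kernel_T" if "\<alpha> \<in> kernel_T" "\<beta> \<in> kernel_T" for \<alpha> \<beta>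
  proof -
    have ab: "\<alpha> \<in> \<A>" "\<beta> \<in> \<A>" using that by (auto simp: kernel_T_def)
    have "T (section_add P \<alpha> \<beta>) C = fib_zero Q C" if C: "C \<in> \<Gamma> // rG" for C
    proof -
      interpret F: comm_group "fiber_group Q C" by (rule comm_group_fiber_Q[OF C])
      show ?thesis
        using T_add[OF C sec[OF ab(1)] fin[OF ab(1) C] sec[OF ab(2)] fin[OF ab(2) C]]
          F.r_one[OF F.one_closed] C \<open>\<alpha> \<in> kernel_T\<close> \<open>\<beta> \<in> kernel_T\<close>
        by (simp add: kernel_T_def)
    qed
    then show ?thesis using ab by (simp add: kernel_T_def sectional_carrier.add)
  qed
  show "inv\<^bsub>sec_group\<^esub> \<alpha> \<in> kernel_T" if "\<alpha> \<in> kernel_T" for \<alpha>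
  proof -
    let ?\<beta> = "inv\<^bsub>sec_group\<^esub> \<alpha>"
    have a: "\<alpha> \<in> \<A>" using that by (auto simp: kernel_T_def)
    have b: "?\<beta> \<in> \<A>" using subgroup.m_inv_closed[OF subgroup_sectional_carrier a] .
    have "T ?\<beta> C = fib_zero Q C" if C: "C \<in> \<Gamma> // rG" for C
    proof -
      interpret F: comm_group "fiber_group Q C" by (rule comm_group_fiber_Q[OF C])
      have "T ?\<beta> C \<otimes>\<^bsub>fiber_group Q C\<^esub> T \<alpha> C = fib_zero Q C"
        using T_add[OF C sec[OF b] fin[OF b C] sec[OF a] fin[OF a C]] T_zero[OF C] sec[OF a]
        by (simp add: S.l_inv)
      moreover have "T \<alpha> C = \<one>\<^bsub>fiber_group Q C\<^esub>"
        using \<open>\<alpha> \<in> kernel_T\<close> C by (simp add: kernel_T_def)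
      ultimately show ?thesis
        using T_in_fiber[OF C sec[OF b] fin[OF b C]] F.r_one[of "T ?\<beta> C"] by simp
    qed
    then show ?thesis using b by (simp add: kernel_T_def)
  qed
qed

lemma generate_subset_kernel: "generate sec_group \<K> \<subseteq> kernel_T"
  by (rule S.generate_subgroup_incl[OF conjugate_differences_subset_kernel subgroup_kernel])

section \<open>Compactly supported functions on the vertex space\<close>

definition bumps :: "'v set \<Rightarrow> ('v \<Rightarrow> 'r) set" where
  "bumps D = {h. continuous_map \<V> euclidean h \<and>
     (\<exists>N. compactin \<V> N \<and> N \<subseteq> D \<and> (\<forall>w\<in>topspace \<V> - N. h w = 0))}"

lemma bumps_mono: "D \<subseteq> D' \<Longrightarrow> bumps D \<subseteq> bumps D'"
  unfolding bumps_def by blast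

lemma bumpsD:
  assumes "h \<in> bumps D"
  shows "continuous_map \<V> euclidean h" "\<And>w. w \<in> topspace \<V> \<Longrightarrow> w \<notin> D \<Longrightarrow> h w = 0"
  using assms unfolding bumps_def by auto

lemma mult_bumps:
  assumes "continuous_map \<V> euclidean k" "h \<in> bumps D" shows "(\<lambda>w. k w * h w) \<in> bumps D"
proof -
  have "continuous_map \<V> euclidean (\<lambda>w. k w * h w)"
    using assms(1) bumpsD(1)[OF assms(2)] by (simp add: continuous_map_atin tendsto_mult)
  then show ?thesis using assms(2) unfolding bumps_def by fastforce
qed

lemma vertex_neighbourhood:
  assumes "openin \<V> D" "v \<in> D"
  obtains M N where "openin \<V> M" "compactin \<V> N" "v \<in> M" "M \<subseteq> N" "N \<subseteq> D"
  using etale_base assms unfolding etale_def neighbourhood_base_of by meson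

text \<open>On a sheet through \<open>\<gamma>\<close> the source map is a homeomorphism, so a function separating closed
  subsets of an \<open>R\<close>-normal neighbourhood of \<open>\<gamma>\<close> descends to the vertex space near \<open>s \<gamma>\<close>. It is
  taken to vanish outside a set with compact closure, so that extending it by zero is continuous.\<close>

lemma exists_bump:
  assumes D: "openin \<V> D" and g: "\<gamma> \<in> \<Gamma>" "s \<gamma> \<in> D"
  obtains h M where "h \<in> bumps D" "openin \<V> M" "s \<gamma> \<in> M" "\<And>w. w \<in> M \<Longrightarrow> h w = 1"
proof -
  have "openin \<G> {x \<in> \<Gamma>. s x \<in> D}"
    using openin_continuous_map_preimage[OF continuous_map_src D] .
  then obtain U where U: "openin \<G> U" "\<gamma> \<in> U" "U \<subseteq> {x \<in> \<Gamma>. s x \<in> D}" "inj_on s U"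
    using src_locally_inj[of "{x \<in> \<Gamma>. s x \<in> D}" \<gamma>] g by auto
  obtain W S where W: "openin \<G> W" "\<gamma> \<in> W" "W \<subseteq> S" "S \<subseteq> U"
    and S: "R_normal TYPE('r) (subtopology \<G> S)"
    using base_locally_R_normal U(1,2) unfolding locally_R_normal_def neighbourhood_base_of by meson
  have inj: "inj_on s W" using U(4) W(3,4) inj_on_subset by blast
  have oW: "openin \<V> (s ` W)" using open_map_src W(1) by (simp add: open_map_def)
  have WD: "s ` W \<subseteq> D" using U(3) W(3,4) by auto
  have SG: "S \<subseteq> \<Gamma>" using U(3) W(4) by auto
  obtain M1 N1 where 1: "openin \<V> M1" "compactin \<V> N1" "s \<gamma> \<in> M1" "M1 \<subseteq> N1" "N1 \<subseteq> s ` W"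
    using vertex_neighbourhood[OF oW, of "s \<gamma>"] W(2) by blast
  obtain M2 N2 where 2: "openin \<V> M2" "compactin \<V> N2" "s \<gamma> \<in> M2" "M2 \<subseteq> N2" "N2 \<subseteq> M1"
    using vertex_neighbourhood[OF 1(1) 1(3)] by blast
  have closed: "closedin (subtopology \<G> S) ({x \<in> \<Gamma>. s x \<in> E} \<inter> S)" if "closedin \<V> E" for E
    using closedin_continuous_map_preimage[OF continuous_map_src that] by (auto simp: closedin_subtopology)
  have cN: "closedin \<V> N1" "closedin \<V> N2"
    using compactin_imp_closedin[OF Hausdorff_vertices] 1(2) 2(2) by auto
  let ?A = "{x \<in> \<Gamma>. s x \<in> topspace \<V> - M1} \<inter> S" let ?B = "{x \<in> \<Gamma>. s x \<in> N2} \<inter> S"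
  have "disjnt ?A ?B" using 2(5) by (auto simp: disjnt_def)
  moreover have "closedin (subtopology \<G> S) ?A" "closedin (subtopology \<G> S) ?B"
    using closed[of "topspace \<V> - M1"] closed[OF cN(2)] 1(1) by (simp_all only: closedin_diff closedin_topspace)
  ultimately obtain f :: "'g \<Rightarrow> 'r" where f: "continuous_map (subtopology \<G> S) euclidean f"
      "\<And>x. x \<in> ?A \<Longrightarrow> f x = 0" "\<And>x. x \<in> ?B \<Longrightarrow> f x = 1"
    using S unfolding R_normal_def by meson
  have "homeomorphic_map (subtopology \<G> W) (subtopology \<V> (s ` W)) s"
    using open_map_inj_on_imp_homeomorphic_map[OF continuous_map_src open_map_src W(1) inj] .
  then obtain t where t: "homeomorphic_maps (subtopology \<G> W) (subtopology \<V> (s ` W)) s t"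
    using homeomorphic_map_maps by blast
  have tW: "t w \<in> W" "s (t w) = w" if "w \<in> s ` W" for w
  proof -
    have "w \<in> topspace (subtopology \<V> (s ` W))" using that openin_subset[OF oW] by auto
    then show "t w \<in> W" "s (t w) = w"
      using t unfolding homeomorphic_maps_def continuous_map_def by (auto simp: Pi_iff)
  qed
  define h where "h w = (if w \<in> M1 then f (t w) else 0)" for w
  have hW: "h w = f (t w)" if "w \<in> s ` W" for w
  proof (cases "w \<in> M1")
    case False
    have "t w \<in> ?A" using tW[OF that] False W(3) SG openin_subset[OF oW] that by auto
    then show ?thesis using False f(2) by (simp add: h_def)
  qed (simp add: h_def)
  have "continuous_map \<V> euclidean h"
  proof (rule pasting_lemma[where I = "UNIV :: bool set"
        and T = "\<lambda>b. if b then s ` W else topspace \<V> - N1" and f = "\<lambda>b w. if b then f (t w) else 0"])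
    fix b :: bool
    show "openin \<V> (if b then s ` W else topspace \<V> - N1)" using oW cN(1) by auto
    have "continuous_map (subtopology \<V> (s ` W)) (subtopology \<G> S) t"
      using t W(3) by (auto simp: homeomorphic_maps_def continuous_map_in_subtopology)
    then have "continuous_map (subtopology \<V> (s ` W)) euclidean (\<lambda>w. f (t w))"
      using continuous_map_compose[OF _ f(1)] by (simp add: o_def)
    then show "continuous_map (subtopology \<V> (if b then s ` W else topspace \<V> - N1)) euclidean
        (\<lambda>w. if b then f (t w) else 0)" by (cases b) auto
  next
    fix b c w
    assume "w \<in> topspace \<V> \<inter> (if b then s ` W else topspace \<V> - N1) \<inter> (if c then s ` W else topspace \<V> - N1)"
    then show "(if b then f (t w) else 0) = (if c then f (t w) else 0)"
      using hW[of w] 1(4) by (auto simp: h_def split: if_splits)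
  next
    fix w assume w: "w \<in> topspace \<V>"
    show "\<exists>b. b \<in> UNIV \<and> w \<in> (if b then s ` W else topspace \<V> - N1) \<and> h w = (if b then f (t w) else 0)"
    proof (cases "w \<in> N1")
      case True
      then show ?thesis using hW 1(5) by (intro exI[of _ True]) auto
    next
      case False
      then show ?thesis using w 1(4) by (intro exI[of _ False]) (auto simp: h_def)
    qed
  qed
  moreover have "\<forall>w\<in>topspace \<V> - N1. h w = 0" using 1(4) by (auto simp: h_def)
  ultimately have "h \<in> bumps D" unfolding bumps_def using 1(2,5) WD by blast
  moreover have "h w = 1" if "w \<in> M2" for w
  proof -
    have w: "w \<in> N2" "w \<in> s ` W" using that 2 1 by (meson subsetD)+
    then have "t w \<in> ?B" using tW[OF w(2)] W(3) SG by auto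
    then show ?thesis using f(3) hW w by simp
  qed
  ultimately show thesis using that 2 by blast
qed

section \<open>Locally negligible sections\<close>

abbreviation "conj_span \<equiv> generate sec_group \<K>"

lemma span_add: "\<alpha> \<in> conj_span \<Longrightarrow> \<beta> \<in> conj_span \<Longrightarrow> section_add P \<alpha> \<beta> \<in> conj_span"
  using generate.eng[of \<alpha> sec_group \<K> \<beta>] by simp

lemma span_zero: "sec_zero \<in> conj_span"
  using generate.one[of sec_group \<K>] by simp

text \<open>The summands of a section near \<open>v\<close> need not have compact support, so that they lie locally in
  the span is tested on their multiples by bump functions.\<close>

definition negligible_at :: "'v \<Rightarrow> ('g \<Rightarrow> 'l) set" where
  "negligible_at v = {\<zeta> \<in> Sec. \<exists>D. openin \<V> D \<and> v \<in> D \<and> (\<forall>h\<in>bumps D. vertex_smul h \<zeta> \<in> conj_span)}"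

lemma negligible_in_Sec: "\<zeta> \<in> negligible_at v \<Longrightarrow> \<zeta> \<in> Sec"
  by (simp add: negligible_at_def)

lemma negligible_add:
  assumes "\<zeta> \<in> negligible_at v" "\<xi> \<in> negligible_at v"
  shows "section_add P \<zeta> \<xi> \<in> negligible_at v"
proof -
  obtain D E where D: "openin \<V> D" "v \<in> D" "\<forall>h\<in>bumps D. vertex_smul h \<zeta> \<in> conj_span"
    and E: "openin \<V> E" "v \<in> E" "\<forall>h\<in>bumps E. vertex_smul h \<xi> \<in> conj_span" and sec: "\<zeta> \<in> Sec" "\<xi> \<in> Sec"
    using assms unfolding negligible_at_def by blast
  have "vertex_smul h (section_add P \<zeta> \<xi>) \<in> conj_span" if "h \<in> bumps (D \<inter> E)" for h
    using that bumps_mono[of "D \<inter> E"] D(3) E(3) by (auto simp: vertex_smul_add[OF sec] intro!: span_add)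
  then show ?thesis
    using D E sec S.m_closed unfolding negligible_at_def by (auto intro!: exI[of _ "D \<inter> E"])
qed

lemma negligible_if_locally_zero:
  assumes z: "\<zeta> \<in> Sec" and D: "openin \<V> D" "v \<in> D"
    and zero: "\<And>\<gamma>. \<gamma> \<in> \<Gamma> \<Longrightarrow> s \<gamma> \<in> D \<Longrightarrow> \<zeta> \<gamma> = zer \<gamma>"
  shows "\<zeta> \<in> negligible_at v"
proof -
  have "vertex_smul h \<zeta> = sec_zero" if "h \<in> bumps D" for h
  proof (rule sec_eqI[OF vertex_smul_in[OF z] S.one_closed])
    fix \<gamma> assume g: "\<gamma> \<in> \<Gamma>"
    show "vertex_smul h \<zeta> \<gamma> = sec_zero \<gamma>"
    proof (cases "s \<gamma> \<in> D")
      case True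
      then show ?thesis using g zero smul_zero by simp
    next
      case False
      then show ?thesis using g bumpsD(2)[OF that src_in] zero_smul sec_apply[OF z] by simp
    qed
  qed
  then show ?thesis using z D span_zero unfolding negligible_at_def by auto
qed

lemma zero_negligible: "v \<in> topspace \<V> \<Longrightarrow> sec_zero \<in> negligible_at v"
  by (rule negligible_if_locally_zero[OF S.one_closed openin_topspace]) auto

text \<open>Multiplying by a bump function with value 1 at the vertex does not change the values on a class
  over it, while the product lies in the span and hence in the kernel.\<close>

lemma negligible_T:
  assumes C: "C \<in> \<Gamma> // rG" "\<gamma> \<in> C" and z: "\<zeta> \<in> negligible_at (s \<gamma>)"
  shows "finite (supp_on C \<zeta>)" "T \<zeta> C = fib_zero Q C"
proof -
  obtain D where D: "openin \<V> D" "s \<gamma> \<in> D" "\<forall>h\<in>bumps D. vertex_smul h \<zeta> \<in> conj_span" and sec: "\<zeta> \<in> Sec"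
    using z unfolding negligible_at_def by blast
  obtain h M where h: "h \<in> bumps D" "s \<gamma> \<in> M" "\<And>w. w \<in> M \<Longrightarrow> h w = 1"
    using exists_bump[OF D(1) class_memD[OF C] D(2)] by metis
  have ker: "vertex_smul h \<zeta> \<in> kernel_T" using D(3) h(1) generate_subset_kernel by blast
  have eq: "vertex_smul h \<zeta> \<gamma>' = \<zeta> \<gamma>'" if "\<gamma>' \<in> C" for \<gamma>'
    using h(3)[OF h(2)] rG_src[OF class_related[OF C that]] class_memD[OF C(1) that] sec_apply[OF sec] one_smul
    by simp
  show "T \<zeta> C = fib_zero Q C"
    using T_cong[OF C(1) vertex_smul_in[OF sec] sec eq] ker C by (simp add: kernel_T_def)
  have "supp_on C \<zeta> = supp_on C (vertex_smul h \<zeta>)" using eq by auto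
  then show "finite (supp_on C \<zeta>)"
    using finite_supp_class[OF _ C(1)] ker by (simp add: kernel_T_def)
qed

section \<open>Sections supported on one sheet\<close>

text \<open>The section is unrestricted over vertices outside \<open>s ` U\<close>. This makes the property stable under
  shrinking \<open>U\<close>, so that sections on two sheets through the same point can be added.\<close>

definition single_sheeted :: "'g set \<Rightarrow> ('g \<Rightarrow> 'l) \<Rightarrow> bool" where
  "single_sheeted U \<beta> \<longleftrightarrow> openin \<G> U \<and> inj_on s U \<and> \<beta> \<in> Sec \<and> cont_on U \<beta> \<and>
     (\<forall>\<gamma>\<in>\<Gamma>. s \<gamma> \<in> s ` U \<longrightarrow> \<gamma> \<notin> U \<longrightarrow> \<beta> \<gamma> = zer \<gamma>)"

lemma single_sheetedD:
  assumes "single_sheeted U \<beta>"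
  shows "openin \<G> U" "inj_on s U" "\<beta> \<in> Sec" "cont_on U \<beta>" "U \<subseteq> \<Gamma>" "openin \<V> (s ` U)"
    "\<And>\<gamma>. \<gamma> \<in> \<Gamma> \<Longrightarrow> s \<gamma> \<in> s ` U \<Longrightarrow> \<gamma> \<notin> U \<Longrightarrow> \<beta> \<gamma> = zer \<gamma>"
  using assms openin_subset[of \<G> U] open_map_src unfolding single_sheeted_def open_map_def by simp_all

lemma single_sheeted_subset:
  assumes "single_sheeted U \<beta>" "openin \<G> V" "V \<subseteq> U" shows "single_sheeted V \<beta>"
  unfolding single_sheeted_def
proof (intro conjI ballI impI)
  note b = single_sheetedD[OF assms(1)]
  show "openin \<G> V" "\<beta> \<in> Sec" by fact+
  show inj: "inj_on s V" using b(2) assms(3) by (rule inj_on_subset)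
  show "cont_on V \<beta>" using b(4) assms(3) by (rule cont_on_subset)
  fix \<gamma> assume g: "\<gamma> \<in> \<Gamma>" "s \<gamma> \<in> s ` V" "\<gamma> \<notin> V"
  then have "\<gamma> \<notin> U" using b(2) assms(3) by (auto simp: inj_on_def)
  then show "\<beta> \<gamma> = zer \<gamma>" using b(7)[OF g(1)] g(2) assms(3) by auto
qed

lemma single_sheeted_add:
  assumes "single_sheeted U \<alpha>" "single_sheeted U \<beta>"
  shows "single_sheeted U (section_add P \<alpha> \<beta>)"
proof -
  note a = single_sheetedD[OF assms(1)] and b = single_sheetedD[OF assms(2)]
  have "section_add P \<alpha> \<beta> \<gamma> = zer \<gamma>" if "\<gamma> \<in> \<Gamma>" "s \<gamma> \<in> s ` U" "\<gamma> \<notin> U" for \<gamma>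
    using a(7)[OF that] b(7)[OF that] that(1) add_zero zero_in_fiber by simp
  then show ?thesis
    using a b(3) cont_on_add[OF a(3) b(3) a(4) b(4)] S.m_closed unfolding single_sheeted_def by blast
qed

lemma Hausdorff_sheet:
  assumes U: "openin \<G> U" "inj_on s U" shows "Hausdorff_space (subtopology \<G> U)"
proof -
  have "homeomorphic_map (subtopology \<G> U) (subtopology \<V> (s ` U)) s"
    using open_map_inj_on_imp_homeomorphic_map[OF continuous_map_src open_map_src U] .
  moreover have "Hausdorff_space (subtopology \<V> (s ` U))"
    using Hausdorff_vertices Hausdorff_space_subtopology by blast
  ultimately show ?thesis
    using homeomorphic_Hausdorff_space homeomorphic_map_imp_homeomorphic_space by blast
qed

lemma single_sheeted_smul_in_Cc:
  assumes b: "single_sheeted U \<beta>" and h: "h \<in> bumps (s ` U)"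
  shows "vertex_smul h \<beta> \<in> Cc P U"
proof -
  note b = single_sheetedD[OF b]
  obtain N where N: "compactin \<V> N" "N \<subseteq> s ` U" "\<forall>w\<in>topspace \<V> - N. h w = 0"
    and hc: "continuous_map \<V> euclidean h"
    using h unfolding bumps_def by blast
  let ?K = "{\<gamma> \<in> U. s \<gamma> \<in> N}"
  have hom: "homeomorphic_map (subtopology \<G> U) (subtopology \<V> (s ` U)) s"
    using open_map_inj_on_imp_homeomorphic_map[OF continuous_map_src open_map_src b(1,2)] .
  have "s ` ?K = N" using N(2) by auto
  then have "compactin (subtopology \<V> (s ` U)) (s ` ?K)"
    using N by (simp add: compactin_subtopology)
  then have "compactin (subtopology \<G> U) ?K"
    using homeomorphic_map_compactness[OF hom, of ?K] b(5) by auto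
  then have "compactin \<G> ?K" by (simp add: compactin_subtopology)
  moreover have "vertex_smul h \<beta> \<gamma> = zer \<gamma>" if "\<gamma> \<in> \<Gamma> - ?K" for \<gamma>
  proof (cases "s \<gamma> \<in> N")
    case True
    then have "\<beta> \<gamma> = zer \<gamma>" using that N(2) b(7)[of \<gamma>] by auto
    then show ?thesis using that smul_zero by simp
  next
    case False
    then show ?thesis using that N(3) src_in zero_smul sec_apply[OF b(3)] by simp
  qed
  ultimately show ?thesis
    unfolding Cc_iff[OF b(1) Hausdorff_sheet[OF b(1,2)]]
    using vertex_smul_in[OF b(3)] cont_on_vertex_smul[OF hc b(3,4)] by blast
qed

text \<open>Since \<open>\<pi>\<close> is a local homeomorphism, two continuous sections that agree at a point agree near
  it. Here they are \<open>\<beta>\<close> and the zero section.\<close>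

lemma single_sheeted_vanishing_negligible:
  assumes b: "single_sheeted U \<beta>" and g: "\<gamma> \<in> U" "\<beta> \<gamma> = zer \<gamma>"
  shows "\<beta> \<in> negligible_at (s \<gamma>)"
proof -
  note b' = single_sheetedD[OF b]
  have gG: "\<gamma> \<in> \<Gamma>" using g b'(5) by blast
  obtain A where A: "openin \<L> A" "zer \<gamma> \<in> A" "inj_on \<pi> A"
    using local_homeomorphism_locally_inj[OF proj_local_homeomorphism zero_in(1)[OF gG]] by metis
  let ?V = "{\<gamma>' \<in> U. \<beta> \<gamma>' \<in> A} \<inter> {\<gamma>' \<in> \<Gamma>. zer \<gamma>' \<in> A}"
  have "openin (subtopology \<G> U) {\<gamma>' \<in> topspace (subtopology \<G> U). \<beta> \<gamma>' \<in> A}"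
    using openin_continuous_map_preimage[OF b'(4) A(1)] .
  moreover have "{\<gamma>' \<in> topspace (subtopology \<G> U). \<beta> \<gamma>' \<in> A} = {\<gamma>' \<in> U. \<beta> \<gamma>' \<in> A}"
    using b'(5) by auto
  ultimately have "openin \<G> {\<gamma>' \<in> U. \<beta> \<gamma>' \<in> A}"
    using openin_open_subtopology[OF b'(1)] by simp
  then have V: "openin \<G> ?V"
    using openin_continuous_map_preimage[OF continuous_map_zero A(1)] by blast
  have zero: "\<beta> \<gamma>' = zer \<gamma>'" if "\<gamma>' \<in> ?V" for \<gamma>'
    using that A(3) sec_apply[OF b'(3), of \<gamma>'] by (auto simp: mem_fiber inj_on_def)
  have "single_sheeted ?V \<beta>" by (rule single_sheeted_subset[OF b V]) auto
  note c = single_sheetedD[OF this]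
  show ?thesis
  proof (rule negligible_if_locally_zero[OF b'(3) c(6)])
    show "s \<gamma> \<in> s ` ?V" using g gG A(2) by auto
    show "\<beta> \<gamma>' = zer \<gamma>'" if "\<gamma>' \<in> \<Gamma>" "s \<gamma>' \<in> s ` ?V" for \<gamma>'
      using c(7)[OF that] zero by blast
  qed
qed

section \<open>Moving a section to an equivalent sheet\<close>

lemma vertex_smul_diff:
  assumes "\<alpha> \<in> Sec" "\<beta> \<in> Sec"
  shows "vertex_smul h (section_diff P \<alpha> \<beta>) = section_diff P (vertex_smul h \<alpha>) (vertex_smul h \<beta>)"
proof (rule sec_eqI)
  fix \<gamma> assume g: "\<gamma> \<in> \<Gamma>"
  note ab = sec_apply[OF assms(1) g] sec_apply[OF assms(2) g]
  have "h (s \<gamma>) \<cdot> (- 1) \<cdot> \<beta> \<gamma> = (- 1) \<cdot> h (s \<gamma>) \<cdot> \<beta> \<gamma>"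
    by (simp add: smul_smul[OF g ab(2)])
  then show "vertex_smul h (section_diff P \<alpha> \<beta>) \<gamma> = section_diff P (vertex_smul h \<alpha>) (vertex_smul h \<beta>) \<gamma>"
    using g assms ab smul_in_fiber(1)[OF g] by (simp add: section_diff_apply vertex_smul_in smul_add)
qed (use assms vertex_smul_in section_diff_in in auto)

text \<open>The sheet \<open>W\<close> consists of the points of \<open>U'\<close> equivalent to points of \<open>U\<close>. Equivalence is
  itself a homeomorphism between \<open>W\<close> and an open part \<open>V\<close> of \<open>U\<close>, and also between the parts of the
  total space above \<open>V\<close> and \<open>W\<close>, because a class meets a fiber at most once. These two maps conjugate
  every function multiple of \<open>\<beta>\<close> with compact support over \<open>s ` V\<close>.\<close>

lemma move_single_sheeted:
  assumes b: "single_sheeted U \<beta>" "\<gamma> \<in> U" and U': "openin \<G> U'" "inj_on s U'" "\<gamma>' \<in> U'"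
    and rel: "(\<gamma>, \<gamma>') \<in> rG"
  obtains W \<beta>' \<zeta> where "\<gamma>' \<in> W" "W \<subseteq> U'" "single_sheeted W \<beta>'" "\<zeta> \<in> negligible_at (s \<gamma>)"
    "\<beta> = section_add P \<zeta> \<beta>'"
proof -
  define V where "V = U \<inter> rG `` U'"
  define W where "W = U' \<inter> rG `` U"
  note bU = single_sheetedD[OF b(1)]
  have sat: "openin \<G> (rG `` D)" if "openin \<G> D" for D
    using open_equivalence_rG that by (simp add: open_equivalence_def)
  have oV: "openin \<G> V" and oW: "openin \<G> W"
    unfolding V_def W_def using sat bU(1) U'(1) by auto
  have bV: "single_sheeted V \<beta>" by (rule single_sheeted_subset[OF b(1) oV]) (auto simp: V_def)
  note bV' = single_sheetedD[OF bV]
  have sub: "V \<subseteq> \<Gamma>" "W \<subseteq> \<Gamma>" using oV oW openin_subset by auto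
  have injW: "inj_on s W" using U'(2) by (rule inj_on_subset) (auto simp: W_def)
  have uniqV: "x = y" if "x \<in> V" "y \<in> V" "(x, y) \<in> rG" for x y
    using bV'(2) that rG_src by (auto simp: inj_on_def)
  have uniqW: "x = y" if "x \<in> W" "y \<in> W" "(x, y) \<in> rG" for x y
    using injW that rG_src by (auto simp: inj_on_def)
  have VW: "V \<subseteq> rG `` W" "W \<subseteq> rG `` V" unfolding V_def W_def using rG_sym by blast+
  have gV: "\<gamma> \<in> V" and gW: "\<gamma>' \<in> W" unfolding V_def W_def using b(2) U'(3) rel rG_sym by blast+
  \<comment> \<open>A sheet meets each class at most once because equivalent points have the same source.\<close>
  obtain \<phi> where hom: "homeomorphic_map (subtopology \<G> W) (subtopology \<G> V) \<phi>"
    and phi: "\<And>x. x \<in> W \<Longrightarrow> \<phi> x \<in> V \<and> (x, \<phi> x) \<in> rG"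
    using open_equivalence_transversals_homeomorphic[OF open_equivalence_rG oW uniqW VW(2) oV uniqV VW(1)]
    by blast
  let ?A = "{x \<in> \<Lambda>. \<pi> x \<in> V}" and ?B = "{x \<in> \<Lambda>. \<pi> x \<in> W}"
  have lift: "{x \<in> \<Lambda>. \<pi> x \<in> D} \<subseteq> rL `` {x \<in> \<Lambda>. \<pi> x \<in> E}" if "D \<subseteq> rG `` E" for D E
  proof
    fix x assume "x \<in> {x \<in> \<Lambda>. \<pi> x \<in> D}"
    then obtain e where e: "x \<in> \<Lambda>" "e \<in> E" "(\<pi> x, e) \<in> rG" using \<open>D \<subseteq> rG `` E\<close> rG_sym by blast
    then obtain y where "(x, y) \<in> rL" "\<pi> y = e" using rL_lift by blast
    then show "x \<in> rL `` {x \<in> \<Lambda>. \<pi> x \<in> E}" using e(2) rL_sym rL_in by blast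
  qed
  have uniq: "x = y" if "(x, y) \<in> rL" "\<pi> x \<in> V \<and> \<pi> y \<in> V \<or> \<pi> x \<in> W \<and> \<pi> y \<in> W" for x y
    using that rL_inj_on_fibers rL_proj uniqV uniqW by blast
  have oA: "openin \<L> ?A" and oB: "openin \<L> ?B"
    using openin_continuous_map_preimage[OF continuous_map_proj] oV oW by auto
  have uniqA: "x = y" if "x \<in> ?A" "y \<in> ?A" "(x, y) \<in> rL" for x y using uniq that by blast
  have uniqB: "x = y" if "x \<in> ?B" "y \<in> ?B" "(x, y) \<in> rL" for x y using uniq that by blast
  obtain \<psi> where homL: "homeomorphic_map (subtopology \<L> ?A) (subtopology \<L> ?B) \<psi>"
    and psi: "\<And>x. x \<in> ?A \<Longrightarrow> \<psi> x \<in> ?B \<and> (x, \<psi> x) \<in> rL"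
    using open_equivalence_transversals_homeomorphic[OF open_equivalence_rL oA uniqA lift[OF VW(1)] oB uniqB lift[OF VW(2)]]
    by blast
  \<comment> \<open>The base point of \<open>\<psi> x\<close> is a point of \<open>W\<close> equivalent to \<open>w\<close>, hence equal to it.\<close>
  have over: "\<pi> (\<psi> x) = w" if "w \<in> W" "x \<in> fiber P (\<phi> w)" for w x
  proof -
    have x: "x \<in> ?A" "\<pi> x = \<phi> w" using that phi by (auto simp: mem_fiber)
    then have "(w, \<pi> (\<psi> x)) \<in> rG" using phi[OF that(1)] rL_proj psi rG_trans by metis
    then show ?thesis using uniqW that(1) psi x by blast
  qed
  have secA: "\<alpha> \<gamma> \<in> ?A" if "\<alpha> \<in> Sec" "\<gamma> \<in> V" for \<alpha> \<gamma>
    using sec_apply[OF that(1), of \<gamma>] that sub by (auto simp: mem_fiber)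
  have phiG: "\<phi> w \<in> \<Gamma>" if "w \<in> W" for w using phi that sub by auto
  define \<beta>' where "\<beta>' = conjugate_section P W \<psi> \<beta> \<phi>"
  have valW: "\<beta>' w = \<psi> (\<beta> (\<phi> w))" if "w \<in> W" for w
    using that sub by (auto simp: \<beta>'_def conjugate_section_def)
  have val0: "\<beta>' w = zer w" if "w \<in> \<Gamma>" "w \<notin> W" for w
    using that by (auto simp: \<beta>'_def conjugate_section_def)
  have b'Sec: "\<beta>' \<in> Sec"
    unfolding \<beta>'_def conjugate_section_def
  proof (rule sec_restrictI)
    fix w assume w: "w \<in> \<Gamma>"
    show "(if w \<in> W then \<psi> (\<beta> (\<phi> w)) else zer w) \<in> fiber P w"
      using over[OF _ sec_apply[OF bU(3) phiG]] psi[OF secA[OF bU(3)]] phi zero_in_fiber[OF w]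
      by (auto simp: mem_fiber)
  qed
  have "cont_on W \<beta>'"
  proof -
    have "continuous_map (subtopology \<G> W) (subtopology \<G> V) \<phi>"
      using hom homeomorphic_imp_continuous_map by blast
    moreover have "continuous_map (subtopology \<G> V) (subtopology \<L> ?A) \<beta>"
      using bV'(4) secA[OF bU(3)] by (auto simp: continuous_map_in_subtopology)
    moreover have "continuous_map (subtopology \<L> ?A) \<L> \<psi>"
      using homeomorphic_imp_continuous_map[OF homL] by (simp add: continuous_map_in_subtopology)
    ultimately have "cont_on W (\<psi> \<circ> (\<beta> \<circ> \<phi>))" by (intro continuous_map_compose)
    then show ?thesis by (rule cont_on_cong) (simp add: valW)
  qed
  then have ss: "single_sheeted W \<beta>'"
    using oW injW b'Sec val0 unfolding single_sheeted_def by blast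
  have diff: "section_diff P \<beta> \<beta>' \<in> negligible_at (s \<gamma>)"
    unfolding negligible_at_def
  proof (intro CollectI conjI exI ballI)
    show "section_diff P \<beta> \<beta>' \<in> Sec" using section_diff_in bU(3) b'Sec by blast
    show "openin \<V> (s ` V)" by (rule bV'(6))
    show "s \<gamma> \<in> s ` V" using gV by blast
    fix h assume h: "h \<in> bumps (s ` V)"
    let ?\<alpha> = "vertex_smul h \<beta>"
    have aSec: "?\<alpha> \<in> Sec" using vertex_smul_in bU(3) by blast
    have "conjugating P rG rL ?\<alpha> V W \<phi> ?A ?B \<psi>"
      unfolding conjugating_def Let_def
    proof (intro conjI ballI)
      show "Hausdorff_space (subtopology \<G> V)" using Hausdorff_sheet oV bV'(2) by blast
      show "?\<alpha> \<in> Cc P V" using single_sheeted_smul_in_Cc[OF bV h] .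
      show "?\<alpha> ` V \<subseteq> ?A" using secA[OF aSec] by blast
      show "\<pi> (\<psi> (?\<alpha> (\<phi> w))) = w" if "w \<in> W" for w
        using over[OF that] sec_apply[OF aSec phiG[OF that]] by blast
    qed (use oV oW oA oB hom homL phi psi in auto)
    then have "section_diff P ?\<alpha> (conjugate_section P W \<psi> ?\<alpha> \<phi>) \<in> \<K>"
      unfolding conjugate_differences_def by blast
    moreover have "conjugate_section P W \<psi> ?\<alpha> \<phi> = vertex_smul h \<beta>'"
    proof
      fix w
      consider "w \<notin> \<Gamma>" | "w \<in> \<Gamma>" "w \<notin> W" | "w \<in> W" "w \<in> \<Gamma>" using sub by blast
      then show "conjugate_section P W \<psi> ?\<alpha> \<phi> w = vertex_smul h \<beta>' w"
      proof cases
        case 3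
        let ?x = "\<beta> (\<phi> w)"
        have x: "?x \<in> fiber P (\<phi> w)" and hx: "h (s w) \<cdot> ?x \<in> fiber P (\<phi> w)"
          using sec_apply[OF bU(3)] phiG 3 smul_in_fiber by auto
        \<comment> \<open>\<open>\<psi>\<close> commutes with scalars: both points are equivalent and lie in one fiber.\<close>
        have "(h (s w) \<cdot> ?x, h (s w) \<cdot> \<psi> ?x) \<in> rL" "(h (s w) \<cdot> ?x, \<psi> (h (s w) \<cdot> ?x)) \<in> rL"
          using psi x hx phi 3 rL_smul by (auto simp: mem_fiber)
        then have "(\<psi> (h (s w) \<cdot> ?x), h (s w) \<cdot> \<psi> ?x) \<in> rL" using rL_sym rL_trans by blast
        moreover have "\<pi> (\<psi> (h (s w) \<cdot> ?x)) = w" using over 3 hx by blast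
        moreover have "\<pi> (h (s w) \<cdot> \<psi> ?x) = w"
          using smul_in_fiber(1)[of w "\<psi> ?x"] sec_apply[OF b'Sec, of w] valW 3 by (simp add: mem_fiber)
        ultimately have "\<psi> (h (s w) \<cdot> ?x) = h (s w) \<cdot> \<psi> ?x" by (intro rL_inj_on_fibers) auto
        moreover have "s (\<phi> w) = s w" using phi 3 rG_src by metis
        ultimately show ?thesis using 3 phiG by (simp add: conjugate_section_def valW)
      qed (use val0 smul_zero in \<open>auto simp: conjugate_section_def vertex_smul_def\<close>)
    qed
    ultimately show "vertex_smul h (section_diff P \<beta> \<beta>') \<in> conj_span"
      using vertex_smul_diff[OF bU(3) b'Sec] generate.incl by metis
  qed
  show thesis
    by (rule that[OF gW _ ss diff]) (use section_diff_add[OF bU(3) b'Sec] in \<open>auto simp: W_def\<close>)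
qed

section \<open>Local reduction to inequivalent sheets\<close>

text \<open>\<open>F\<close> is the set of points at which the sheets pass over \<open>v\<close>; no two of them are equivalent.\<close>

inductive reduced :: "'v \<Rightarrow> 'g set \<Rightarrow> ('g \<Rightarrow> 'l) \<Rightarrow> bool" for v where
  zero: "reduced v {} sec_zero"
| sheet: "\<lbrakk>reduced v F \<sigma>; single_sheeted U \<beta>; \<gamma> \<in> U; s \<gamma> = v; \<forall>\<gamma>'\<in>F. (\<gamma>, \<gamma>') \<notin> rG\<rbrakk>
    \<Longrightarrow> reduced v (insert \<gamma> F) (section_add P \<beta> \<sigma>)"

lemma sheet_meets_fiber_once:
  assumes "single_sheeted U \<beta>" "\<gamma> \<in> U" "\<gamma>' \<in> \<Gamma>" "s \<gamma>' = s \<gamma>" "\<gamma>' \<noteq> \<gamma>" shows "\<beta> \<gamma>' = zer \<gamma>'"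
proof -
  note b = single_sheetedD[OF assms(1)]
  have "\<gamma>' \<notin> U" using b(2) assms by (auto simp: inj_on_def)
  then show ?thesis using b(7) assms by auto
qed

lemma reduced_vanishes:
  assumes "reduced v F \<sigma>"
  shows "\<sigma> \<in> Sec \<and> finite F \<and> (\<forall>\<gamma>\<in>\<Gamma>. s \<gamma> = v \<longrightarrow> \<gamma> \<notin> F \<longrightarrow> \<sigma> \<gamma> = zer \<gamma>)"
  using assms
proof induction
  case zero
  then show ?case using S.one_closed by auto
next
  case (sheet F \<sigma> U \<beta> \<gamma>)
  have "section_add P \<beta> \<sigma> \<gamma>' = zer \<gamma>'" if "\<gamma>' \<in> \<Gamma>" "s \<gamma>' = v" "\<gamma>' \<notin> insert \<gamma> F" for \<gamma>'
    using that sheet.IH sheet_meets_fiber_once[OF sheet.hyps(2,3), of \<gamma>'] sheet.hyps(4)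
      add_zero zero_in_fiber by simp
  then show ?case using sheet.IH single_sheetedD(3)[OF sheet.hyps(2)] S.m_closed by auto
qed

text \<open>The new sheet either passes over \<open>v\<close> at a point equivalent to that of an existing sheet, and is
  then moved onto it and merged with it, or it remains separate.\<close>

lemma add_sheet_reduced:
  assumes "reduced v F \<sigma>" "single_sheeted U \<beta>" "\<gamma> \<in> U" "s \<gamma> = v"
  shows "\<exists>F' \<sigma>' \<zeta>. F' \<subseteq> insert \<gamma> F \<and> reduced v F' \<sigma>' \<and> \<zeta> \<in> negligible_at v \<and>
    section_add P \<beta> \<sigma> = section_add P \<sigma>' \<zeta>"
  using assms
proof induction
  case zero
  have b: "\<beta> \<in> Sec" and v: "v \<in> topspace \<V>"
    using single_sheetedD(3,5)[OF zero(1)] zero src_in by auto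
  have "reduced v {\<gamma>} (section_add P \<beta> sec_zero)"
    by (rule reduced.sheet[OF reduced.zero]) (use zero in auto)
  moreover have "section_add P \<beta> sec_zero = section_add P (section_add P \<beta> sec_zero) sec_zero"
    using b by simp
  ultimately show ?case using zero_negligible[OF v] by blast
next
  case (sheet F \<sigma> U1 \<beta>1 \<gamma>1)
  note b = single_sheetedD[OF sheet.prems(1)] and b1 = single_sheetedD[OF sheet.hyps(2)]
  have sSec: "\<sigma> \<in> Sec" using reduced_vanishes sheet.hyps(1) by blast
  show ?case
  proof (cases "(\<gamma>, \<gamma>1) \<in> rG")
    case True
    then obtain W \<beta>' \<zeta> where W: "\<gamma>1 \<in> W" "W \<subseteq> U1" "single_sheeted W \<beta>'"
      and z: "\<zeta> \<in> negligible_at (s \<gamma>)" and eq: "\<beta> = section_add P \<zeta> \<beta>'"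
      using move_single_sheeted[OF sheet.prems(1,2) b1(1,2) sheet.hyps(3)] by metis
    have "single_sheeted W \<beta>1"
      using single_sheeted_subset[OF sheet.hyps(2)] W single_sheetedD(1) by blast
    then have red: "reduced v (insert \<gamma>1 F) (section_add P (section_add P \<beta>' \<beta>1) \<sigma>)"
      using reduced.sheet[OF sheet.hyps(1) single_sheeted_add[OF W(3)] W(1)] sheet.hyps(4,5) by blast
    have "section_add P \<beta> (section_add P \<beta>1 \<sigma>) = section_add P (section_add P (section_add P \<beta>' \<beta>1) \<sigma>) \<zeta>"
      unfolding eq using negligible_in_Sec[OF z] single_sheetedD(3)[OF W(3)] b1(3) sSec
      by (simp add: S.m_ac)
    then show ?thesis using red z sheet.prems(3) by blast
  next
    case False
    obtain F' \<sigma>' \<zeta> where IH: "F' \<subseteq> insert \<gamma> F" "reduced v F' \<sigma>'" "\<zeta> \<in> negligible_at v"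
      "section_add P \<beta> \<sigma> = section_add P \<sigma>' \<zeta>"
      using sheet.IH[OF sheet.prems] by blast
    have s'Sec: "\<sigma>' \<in> Sec" using reduced_vanishes IH(2) by blast
    have "\<forall>\<gamma>'\<in>F'. (\<gamma>1, \<gamma>') \<notin> rG" using IH(1) sheet.hyps(5) False rG_sym by blast
    then have red: "reduced v (insert \<gamma>1 F') (section_add P \<beta>1 \<sigma>')"
      using reduced.sheet[OF IH(2) sheet.hyps(2-4)] by blast
    have "section_add P \<beta> (section_add P \<beta>1 \<sigma>) = section_add P \<beta>1 (section_add P \<beta> \<sigma>)"
      using b(3) b1(3) sSec by (simp add: S.m_ac)
    also have "\<dots> = section_add P (section_add P \<beta>1 \<sigma>') \<zeta>"
      unfolding IH(4) using b1(3) s'Sec negligible_in_Sec[OF IH(3)] by (simp add: S.m_ac)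
    finally show ?thesis using red IH(1,3) by blast
  qed
qed

definition reducible_at :: "'v \<Rightarrow> ('g \<Rightarrow> 'l) \<Rightarrow> bool" where
  "reducible_at v \<alpha> \<longleftrightarrow> (\<exists>F \<sigma> \<zeta>. reduced v F \<sigma> \<and> \<zeta> \<in> negligible_at v \<and> \<alpha> = section_add P \<sigma> \<zeta>)"

lemma reducible_add_sheet:
  assumes a: "reducible_at v \<alpha>" and b: "single_sheeted U \<beta>" "\<gamma> \<in> U" "s \<gamma> = v"
  shows "reducible_at v (section_add P \<beta> \<alpha>)"
proof -
  obtain F \<sigma> \<zeta> where r: "reduced v F \<sigma>" "\<zeta> \<in> negligible_at v" "\<alpha> = section_add P \<sigma> \<zeta>"
    using a unfolding reducible_at_def by blast
  obtain F' \<sigma>' \<xi> where r': "reduced v F' \<sigma>'" "\<xi> \<in> negligible_at v"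
    "section_add P \<beta> \<sigma> = section_add P \<sigma>' \<xi>"
    using add_sheet_reduced[OF r(1) b] by blast
  have sec: "\<sigma> \<in> Sec" "\<sigma>' \<in> Sec" "\<zeta> \<in> Sec" "\<xi> \<in> Sec" "\<beta> \<in> Sec"
    using reduced_vanishes r r' negligible_in_Sec single_sheetedD(3)[OF b(1)] by auto
  have "section_add P \<beta> \<alpha> = section_add P (section_add P \<beta> \<sigma>) \<zeta>"
    unfolding r(3) using sec by (simp add: S.m_assoc)
  also have "\<dots> = section_add P \<sigma>' (section_add P \<xi> \<zeta>)"
    unfolding r'(3) using sec by (simp add: S.m_assoc)
  finally show ?thesis
    using r' negligible_add[OF r'(2) r(2)] unfolding reducible_at_def by blast
qed

lemma reducible_add_reduced:
  assumes "reduced v F \<sigma>" "reducible_at v \<alpha>" "\<alpha> \<in> Sec"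
  shows "reducible_at v (section_add P \<sigma> \<alpha>)"
  using assms
proof induction
  case zero
  then show ?case by simp
next
  case (sheet F \<sigma> U \<beta> \<gamma>)
  have "\<sigma> \<in> Sec" "\<beta> \<in> Sec" using reduced_vanishes sheet.hyps(1) single_sheetedD(3)[OF sheet.hyps(2)] by auto
  then show ?case
    using reducible_add_sheet[OF sheet.IH sheet.hyps(2-4)] sheet.prems by (simp add: S.m_assoc)
qed

lemma reducible_add:
  assumes a: "reducible_at v \<alpha>" and b: "reducible_at v \<beta>" "\<beta> \<in> Sec"
  shows "reducible_at v (section_add P \<alpha> \<beta>)"
proof -
  obtain F \<sigma> \<zeta> where r: "reduced v F \<sigma>" "\<zeta> \<in> negligible_at v" "\<alpha> = section_add P \<sigma> \<zeta>"
    using a unfolding reducible_at_def by blast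
  obtain F' \<sigma>' \<xi> where r': "reduced v F' \<sigma>'" "\<xi> \<in> negligible_at v"
    "section_add P \<sigma> \<beta> = section_add P \<sigma>' \<xi>"
    using reducible_add_reduced[OF r(1) b] unfolding reducible_at_def by blast
  have sec: "\<sigma> \<in> Sec" "\<sigma>' \<in> Sec" "\<zeta> \<in> Sec" "\<xi> \<in> Sec"
    using reduced_vanishes r r' negligible_in_Sec by auto
  have "section_add P \<alpha> \<beta> = section_add P (section_add P \<sigma> \<beta>) \<zeta>"
    unfolding r(3) using sec b(2) by (simp add: S.m_ac)
  also have "\<dots> = section_add P \<sigma>' (section_add P \<xi> \<zeta>)"
    unfolding r'(3) using sec by (simp add: S.m_assoc)
  finally show ?thesis
    using r' negligible_add[OF r'(2) r(2)] unfolding reducible_at_def by blast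
qed

lemma reducible_if_locally_zero:
  assumes "\<alpha> \<in> Sec" "openin \<V> D" "v \<in> D" "\<And>\<gamma>. \<gamma> \<in> \<Gamma> \<Longrightarrow> s \<gamma> \<in> D \<Longrightarrow> \<alpha> \<gamma> = zer \<gamma>"
  shows "reducible_at v \<alpha>"
  using negligible_if_locally_zero[OF assms] reduced.zero assms(1) S.l_one[of \<alpha>]
  unfolding reducible_at_def by metis

text \<open>The last assumption says that, near \<open>v\<close>, the support of \<open>\<alpha>\<close> shrinks to \<open>F\<close>. The points of \<open>F\<close>
  are split off one at a time, using disjoint neighbourhoods in the Hausdorff set \<open>V\<close>.\<close>

lemma reducible_if_support_shrinks:
  assumes "finite F" "openin \<G> V" "Hausdorff_space (subtopology \<G> V)" "F \<subseteq> V" "\<And>\<gamma>. \<gamma> \<in> F \<Longrightarrow> s \<gamma> = v"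
    "\<alpha> \<in> Sec" "cont_on V \<alpha>"
    "\<And>V'. openin \<G> V' \<Longrightarrow> F \<subseteq> V' \<Longrightarrow>
       \<exists>D. openin \<V> D \<and> v \<in> D \<and> (\<forall>\<gamma>\<in>\<Gamma>. s \<gamma> \<in> D \<longrightarrow> \<gamma> \<notin> V' \<longrightarrow> \<alpha> \<gamma> = zer \<gamma>)"
  shows "reducible_at v \<alpha>"
  using assms
proof (induction F arbitrary: V \<alpha> rule: finite_induct)
  case empty
  obtain D where "openin \<V> D" "v \<in> D" "\<forall>\<gamma>\<in>\<Gamma>. s \<gamma> \<in> D \<longrightarrow> \<gamma> \<notin> {} \<longrightarrow> \<alpha> \<gamma> = zer \<gamma>"
    using empty(7)[of "{}"] by auto
  then show ?case using reducible_if_locally_zero empty(5) by blast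
next
  case (insert \<gamma> F)
  have VG: "V \<subseteq> \<Gamma>" using insert.prems(1) openin_subset by blast
  have "compactin (subtopology \<G> V) {\<gamma>}" "compactin (subtopology \<G> V) F" "disjnt {\<gamma>} F"
    using insert.prems(3) insert.hyps VG by (auto simp: finite_imp_compactin_eq)
  then obtain A B where AB: "openin (subtopology \<G> V) A" "openin (subtopology \<G> V) B" "\<gamma> \<in> A" "F \<subseteq> B" "disjnt A B"
    using Hausdorff_space_compact_separation[OF insert.prems(2)] by (metis insert_subset)
  then have oAB: "openin \<G> A" "openin \<G> B" "A \<subseteq> V" "B \<subseteq> V"
    using openin_open_subtopology[OF insert.prems(1)] by auto
  obtain U where U: "openin \<G> U" "\<gamma> \<in> U" "U \<subseteq> A" "inj_on s U"
    using src_locally_inj[OF oAB(1) AB(3)] by blast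
  have disj: "U \<inter> B = {}" using AB(5) U(3) by (auto simp: disjnt_def)
  let ?\<beta> = "\<lambda>\<gamma>\<in>\<Gamma>. if \<gamma> \<in> U then \<alpha> \<gamma> else zer \<gamma>"
  let ?\<delta> = "\<lambda>\<gamma>\<in>\<Gamma>. if \<gamma> \<in> U then zer \<gamma> else \<alpha> \<gamma>"
  have sec: "?\<beta> \<in> Sec" "?\<delta> \<in> Sec"
    using sec_apply[OF insert.prems(5)] zero_in_fiber by (auto intro!: sec_restrictI)
  have "U \<subseteq> V" using U(3) oAB(3) by blast
  then have "cont_on U ?\<beta>"
    by (rule cont_on_cong[OF cont_on_subset[OF insert.prems(6)]]) auto
  then have ss: "single_sheeted U ?\<beta>"
    using U sec(1) unfolding single_sheeted_def by auto
  have cB: "cont_on B ?\<delta>"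
    by (rule cont_on_cong[OF cont_on_subset[OF insert.prems(6) oAB(4)]]) (use disj in auto)
  have HB: "Hausdorff_space (subtopology \<G> B)"
    using Hausdorff_space_subtopology[OF insert.prems(2), of B] oAB(4)
    by (simp add: subtopology_subtopology Int_absorb1)
  have "reducible_at v ?\<delta>"
  proof (rule insert.IH[OF oAB(2) HB AB(4) _ sec(2) cB])
    show "s \<gamma>' = v" if "\<gamma>' \<in> F" for \<gamma>' using insert.prems(4) that by blast
    fix V' assume V': "openin \<G> V'" "F \<subseteq> V'"
    then have "openin \<G> (U \<union> V')" "insert \<gamma> F \<subseteq> U \<union> V'" using U by auto
    then obtain D where "openin \<V> D" "v \<in> D" "\<forall>\<gamma>\<in>\<Gamma>. s \<gamma> \<in> D \<longrightarrow> \<gamma> \<notin> U \<union> V' \<longrightarrow> \<alpha> \<gamma> = zer \<gamma>"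
      using insert.prems(7)[of "U \<union> V'"] by blast
    then show "\<exists>D. openin \<V> D \<and> v \<in> D \<and> (\<forall>\<gamma>\<in>\<Gamma>. s \<gamma> \<in> D \<longrightarrow> \<gamma> \<notin> V' \<longrightarrow> ?\<delta> \<gamma> = zer \<gamma>)"
      by (intro exI[of _ D]) auto
  qed
  then have "reducible_at v (section_add P ?\<beta> ?\<delta>)"
    using reducible_add_sheet[OF _ ss U(2)] insert.prems(4) by blast
  moreover have "section_add P ?\<beta> ?\<delta> = \<alpha>"
    by (rule sec_eqI) (use sec insert.prems(5) sec_apply[OF insert.prems(5)] add_zero S.m_closed in auto)
  ultimately show ?case by simp
qed

lemma compactin_src_image: "compactin \<G> K \<Longrightarrow> compactin \<V> (s ` K)"
  using image_compactin continuous_map_src by blast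

text \<open>For a section vanishing outside a compact set \<open>K\<close>, the support over small neighbourhoods of \<open>v\<close>
  shrinks to the points of \<open>K\<close> over \<open>v\<close>, because images of compact sets are closed in the Hausdorff
  vertex space.\<close>

lemma sectional_carrier_reducible:
  assumes "\<alpha> \<in> \<A>" and v: "v \<in> topspace \<V>"
  shows "reducible_at v \<alpha>"
  using assms(1)
proof (induction rule: sectional_carrier_sum_induct)
  case (Cc V \<alpha>)
  then obtain K where K: "\<alpha> \<in> Sec" "cont_on V \<alpha>" "compactin \<G> K" "K \<subseteq> V" "\<forall>\<gamma>\<in>\<Gamma> - K. \<alpha> \<gamma> = zer \<gamma>"
    using Cc_iff by metis
  let ?F = "{\<gamma> \<in> K. s \<gamma> = v}"
  show ?case
  proof (rule reducible_if_support_shrinks[OF compactin_finite_src_fiber[OF K(3)] Cc(1,2) _ _ K(1,2)])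
    show "?F \<subseteq> V" using K(4) by blast
    fix V' assume V': "openin \<G> V'" "?F \<subseteq> V'"
    have "compactin \<G> (K \<inter> (\<Gamma> - V'))"
      using compact_Int_closedin[OF K(3)] V'(1) by blast
    then have "closedin \<V> (s ` (K \<inter> (\<Gamma> - V')))"
      using compactin_imp_closedin[OF Hausdorff_vertices compactin_src_image] by blast
    then have "openin \<V> (topspace \<V> - s ` (K \<inter> (\<Gamma> - V')))" by blast
    then show "\<exists>D. openin \<V> D \<and> v \<in> D \<and> (\<forall>\<gamma>\<in>\<Gamma>. s \<gamma> \<in> D \<longrightarrow> \<gamma> \<notin> V' \<longrightarrow> \<alpha> \<gamma> = zer \<gamma>)"
      using v V'(2) K(5) by (intro exI[of _ "topspace \<V> - s ` (K \<inter> (\<Gamma> - V'))"]) auto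
  qed simp
next
  case (add \<alpha> \<beta>)
  then show ?case using reducible_add sectional_carrier_subset_Sec by blast
qed

section \<open>The kernel\<close>

text \<open>On the class of its own point over \<open>v\<close> every summand stands alone, so its value there is zero,
  and \<open>single_sheeted_vanishing_negligible\<close> applies.\<close>

lemma reduced_negligible:
  assumes "reduced v F \<sigma>" "v \<in> topspace \<V>"
    and "\<And>C \<gamma>. C \<in> \<Gamma> // rG \<Longrightarrow> \<gamma> \<in> C \<Longrightarrow> s \<gamma> = v \<Longrightarrow> T \<sigma> C = fib_zero Q C"
  shows "\<sigma> \<in> negligible_at v"
  using assms
proof induction
  case zero
  then show ?case using zero_negligible by blast
next
  case (sheet F \<sigma> U \<beta> \<gamma>)
  note b = single_sheetedD[OF sheet.hyps(2)]
  have r: "\<sigma> \<in> Sec" "\<And>\<gamma>. \<gamma> \<in> \<Gamma> \<Longrightarrow> s \<gamma> = v \<Longrightarrow> \<gamma> \<notin> F \<Longrightarrow> \<sigma> \<gamma> = zer \<gamma>"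
    using reduced_vanishes[OF sheet.hyps(1)] by auto
  have sum: "section_add P \<beta> \<sigma> \<in> Sec" using b(3) r(1) S.m_closed by blast
  have gG: "\<gamma> \<in> \<Gamma>" using b(5) sheet.hyps(3) by blast
  define C where "C = rG `` {\<gamma>}"
  have C: "C \<in> \<Gamma> // rG" "\<gamma> \<in> C"
    using gG rG_refl by (auto simp: C_def quotientI)
  have off: "\<sigma> \<gamma>' = zer \<gamma>'" if "\<gamma>' \<in> C" for \<gamma>'
  proof -
    have rel: "(\<gamma>, \<gamma>') \<in> rG" using that by (simp add: C_def)
    show ?thesis
      using r(2)[OF rG_in(2)[OF rel]] rG_src[OF rel] rel sheet.hyps(4,5) by auto
  qed
  have val: "section_add P \<beta> \<sigma> \<gamma> = \<beta> \<gamma>"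
    using off[OF C(2)] gG add_zero sec_apply[OF b(3) gG] by simp
  have supp: "supp_on C (section_add P \<beta> \<sigma>) \<subseteq> {\<gamma>}"
  proof
    fix \<gamma>' assume g': "\<gamma>' \<in> supp_on C (section_add P \<beta> \<sigma>)"
    then have "\<gamma>' \<in> \<Gamma>" "s \<gamma>' = s \<gamma>" using rG_src rG_in unfolding C_def by auto
    then show "\<gamma>' \<in> {\<gamma>}"
      using g' off[of \<gamma>'] sheet_meets_fiber_once[OF sheet.hyps(2,3), of \<gamma>'] add_zero[OF _ zero_in_fiber, of \<gamma>']
      by (cases "\<gamma>' = \<gamma>") auto
  qed
  interpret F: comm_group "fiber_group Q C" by (rule comm_group_fiber_Q[OF C(1)])
  have "T (section_add P \<beta> \<sigma>) C = finprod (fiber_group Q C) (\<lambda>\<gamma>. \<lbrakk>section_add P \<beta> \<sigma> \<gamma>\<rbrakk>) {\<gamma>}"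
    by (rule T_eq_finprod[OF C(1) sum]) (use supp C in auto)
  also have "\<dots> = \<lbrakk>\<beta> \<gamma>\<rbrakk>"
    using F.finprod_insert[of "{}" \<gamma> "\<lambda>\<gamma>. \<lbrakk>section_add P \<beta> \<sigma> \<gamma>\<rbrakk>"] cls_sec[OF C(1) sum C(2)] val F.r_one by simp
  finally have "\<lbrakk>\<beta> \<gamma>\<rbrakk> = fib_zero Q C" using sheet.prems(2)[OF C sheet.hyps(4)] by simp
  then have zero: "\<beta> \<gamma> = zer \<gamma>" using cls_eq_zero_iff[OF C sec_apply[OF b(3) gG]] by simp
  then have neg: "\<beta> \<in> negligible_at v"
    using single_sheeted_vanishing_negligible[OF sheet.hyps(2,3)] sheet.hyps(4) by simp
  have bz: "\<beta> \<gamma>' = zer \<gamma>'" if "\<gamma>' \<in> \<Gamma>" "s \<gamma>' = v" for \<gamma>'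
    using that zero sheet_meets_fiber_once[OF sheet.hyps(2,3)] sheet.hyps(4) by (cases "\<gamma>' = \<gamma>") auto
  have "\<sigma> \<in> negligible_at v"
  proof (rule sheet.IH[OF sheet.prems(1)])
    fix D \<gamma>'' assume D: "D \<in> \<Gamma> // rG" "\<gamma>'' \<in> D" "s \<gamma>'' = v"
    have "\<sigma> \<gamma>' = section_add P \<beta> \<sigma> \<gamma>'" if "\<gamma>' \<in> D" for \<gamma>'
      using bz[of \<gamma>'] class_memD[OF D(1) that] rG_src[OF class_related[OF D(1,2) that]] D(3)
        add_zero sec_apply[OF r(1)] by simp
    then have "T \<sigma> D = T (section_add P \<beta> \<sigma>) D" by (rule T_cong[OF D(1) r(1) sum])
    then show "T \<sigma> D = fib_zero Q D" using sheet.prems(2)[OF D] by simp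
  qed
  then show ?case using negligible_add[OF neg] by blast
qed

text \<open>Negligible sections do not contribute to sums over classes above \<open>v\<close>, so the reduced part of \<open>\<alpha>\<close>
  has vanishing sums there as well.\<close>

lemma kernel_negligible:
  assumes a: "\<alpha> \<in> kernel_T" and v: "v \<in> topspace \<V>"
  shows "\<alpha> \<in> negligible_at v"
proof -
  have aA: "\<alpha> \<in> \<A>" using a by (simp add: kernel_T_def)
  obtain F \<sigma> \<zeta> where r: "reduced v F \<sigma>" "\<zeta> \<in> negligible_at v" "\<alpha> = section_add P \<sigma> \<zeta>"
    using sectional_carrier_reducible[OF aA v] unfolding reducible_at_def by blast
  note rv = reduced_vanishes[OF r(1)]
  have "\<sigma> \<in> negligible_at v"
  proof (rule reduced_negligible[OF r(1) v])
    fix C \<gamma> assume C: "C \<in> \<Gamma> // rG" "\<gamma> \<in> C" "s \<gamma> = v"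
    interpret F: comm_group "fiber_group Q C" by (rule comm_group_fiber_Q[OF C(1)])
    have "supp_on C \<sigma> \<subseteq> F"
      using rv class_memD[OF C(1)] rG_src[OF class_related[OF C(1,2)]] C(3) by auto
    then have fin: "finite (supp_on C \<sigma>)" using rv finite_subset by blast
    have z: "finite (supp_on C \<zeta>)" "T \<zeta> C = fib_zero Q C"
      using negligible_T[OF C(1,2)] r(2) C(3) by auto
    have "T \<alpha> C = T \<sigma> C \<otimes>\<^bsub>fiber_group Q C\<^esub> T \<zeta> C"
      unfolding r(3) using T_add[OF C(1) _ fin _ z(1)] rv negligible_in_Sec[OF r(2)] by blast
    moreover have "T \<alpha> C = fib_zero Q C" using a C(1) by (simp add: kernel_T_def)
    ultimately show "T \<sigma> C = fib_zero Q C"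
      using z(2) F.r_one[of "T \<sigma> C"] T_in_fiber[OF C(1) _ fin] rv by simp
  qed
  then show ?thesis unfolding r(3) using negligible_add r(2) by blast
qed

lemma compact_source_support:
  "\<alpha> \<in> \<A> \<Longrightarrow> \<exists>K. compactin \<G> K \<and> (\<forall>\<gamma>\<in>\<Gamma>. s \<gamma> \<notin> s ` K \<longrightarrow> \<alpha> \<gamma> = zer \<gamma>)"
proof (induction rule: sectional_carrier_sum_induct)
  case (Cc V \<alpha>)
  then obtain K where "compactin \<G> K" "\<forall>\<gamma>\<in>\<Gamma> - K. \<alpha> \<gamma> = zer \<gamma>" using Cc_iff by metis
  then show ?case by blast
next
  case (add \<alpha> \<beta>)
  then obtain K K' where "compactin \<G> K" "\<forall>\<gamma>\<in>\<Gamma>. s \<gamma> \<notin> s ` K \<longrightarrow> \<alpha> \<gamma> = zer \<gamma>"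
    "compactin \<G> K'" "\<forall>\<gamma>\<in>\<Gamma>. s \<gamma> \<notin> s ` K' \<longrightarrow> \<beta> \<gamma> = zer \<gamma>" by blast
  then show ?case
    using compactin_Un add_zero zero_in_fiber by (intro exI[of _ "K \<union> K'"]) (auto simp: image_Un)
qed

text \<open>The functions \<open>f\<close> and \<open>1 - f\<close> play the part of a partition of unity: passing from \<open>f\<close> to
  \<open>f (1 - h)\<close> moves the multiple \<open>f h\<close> of the bump function \<open>h\<close>, which is again a bump function,
  into the other summand.\<close>

lemma negligible_partition:
  assumes a: "\<alpha> \<in> Sec" and "finite \<M>"
    and "\<And>M. M \<in> \<M> \<Longrightarrow> \<exists>D h. (\<forall>k\<in>bumps D. vertex_smul k \<alpha> \<in> conj_span) \<and> h \<in> bumps D \<and> (\<forall>w\<in>M. h w = 1)"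
  shows "\<exists>f. continuous_map \<V> euclidean f \<and> (\<forall>w\<in>\<Union>\<M>. f w = 0) \<and> vertex_smul (\<lambda>w. 1 - f w) \<alpha> \<in> conj_span"
  using assms(2,3)
proof (induction rule: finite_induct)
  case empty
  have "vertex_smul (\<lambda>w. 1 - 1) \<alpha> = sec_zero"
    by (rule sec_eqI) (use a vertex_smul_in S.one_closed zero_smul sec_apply in auto)
  then show ?case using span_zero by (intro exI[of _ "\<lambda>_. 1"]) auto
next
  case (insert M \<M>)
  obtain f where f: "continuous_map \<V> euclidean f" "\<forall>w\<in>\<Union>\<M>. f w = 0" "vertex_smul (\<lambda>w. 1 - f w) \<alpha> \<in> conj_span"
    using insert.IH insert.prems by auto
  obtain D h where h: "\<forall>k\<in>bumps D. vertex_smul k \<alpha> \<in> conj_span" "h \<in> bumps D" "\<forall>w\<in>M. h w = 1"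
    using insert.prems[of M] by blast
  let ?f = "\<lambda>w. f w * (1 - h w)"
  have "continuous_map \<V> euclidean ?f"
    using f(1) bumpsD(1)[OF h(2)]
    by (auto simp: continuous_map_atin intro!: tendsto_intros)
  moreover have "\<forall>w\<in>\<Union>(insert M \<M>). ?f w = 0" using f(2) h(3) by auto
  moreover have "vertex_smul (\<lambda>w. 1 - ?f w) \<alpha> \<in> conj_span"
  proof -
    have "vertex_smul (\<lambda>w. 1 - ?f w) \<alpha>
        = section_add P (vertex_smul (\<lambda>w. 1 - f w) \<alpha>) (vertex_smul (\<lambda>w. f w * h w) \<alpha>)"
      by (rule sec_eqI)
        (use a vertex_smul_in S.m_closed sec_apply in \<open>auto simp: add_smul[symmetric] algebra_simps\<close>)
    then show ?thesis using f(3) h(1) mult_bumps[OF f(1) h(2)] span_add by simp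
  qed
  ultimately show ?case by blast
qed

lemma kernel_subset_generate: "kernel_T \<subseteq> conj_span"
proof
  fix \<alpha> assume a: "\<alpha> \<in> kernel_T"
  then have aA: "\<alpha> \<in> \<A>" and aSec: "\<alpha> \<in> Sec"
    using sectional_carrier_subset_Sec by (auto simp: kernel_T_def)
  obtain K where K: "compactin \<G> K" "\<forall>\<gamma>\<in>\<Gamma>. s \<gamma> \<notin> s ` K \<longrightarrow> \<alpha> \<gamma> = zer \<gamma>"
    using compact_source_support[OF aA] by blast
  let ?\<U> = "{M. openin \<V> M \<and> (\<exists>D h. (\<forall>k\<in>bumps D. vertex_smul k \<alpha> \<in> conj_span) \<and> h \<in> bumps D \<and> (\<forall>w\<in>M. h w = 1))}"
  have "s ` K \<subseteq> \<Union>?\<U>"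
  proof
    fix v assume "v \<in> s ` K"
    then obtain \<gamma> where g: "\<gamma> \<in> \<Gamma>" "v = s \<gamma>" using compactin_subset_topspace[OF K(1)] by blast
    obtain D where D: "openin \<V> D" "v \<in> D" "\<forall>k\<in>bumps D. vertex_smul k \<alpha> \<in> conj_span"
      using kernel_negligible[OF a src_in[OF g(1)]] g(2) unfolding negligible_at_def by blast
    obtain h M where "h \<in> bumps D" "openin \<V> M" "v \<in> M" "\<And>w. w \<in> M \<Longrightarrow> h w = 1"
      using exists_bump[OF D(1) g(1)] D(2) g(2) by metis
    then show "v \<in> \<Union>?\<U>" using D(3) by blast
  qed
  then obtain \<M> where M: "finite \<M>" "\<M> \<subseteq> ?\<U>" "s ` K \<subseteq> \<Union>\<M>"
    using compactinD[OF compactin_src_image[OF K(1)], of ?\<U>] by auto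
  obtain f where f: "\<forall>w\<in>\<Union>\<M>. f w = 0" "vertex_smul (\<lambda>w. 1 - f w) \<alpha> \<in> conj_span"
    using negligible_partition[OF aSec M(1)] M(2) by blast
  have "vertex_smul (\<lambda>w. 1 - f w) \<alpha> = \<alpha>"
  proof (rule sec_eqI[OF vertex_smul_in[OF aSec] aSec])
    fix \<gamma> assume g: "\<gamma> \<in> \<Gamma>"
    show "vertex_smul (\<lambda>w. 1 - f w) \<alpha> \<gamma> = \<alpha> \<gamma>"
    proof (cases "s \<gamma> \<in> s ` K")
      case True
      then have "f (s \<gamma>) = 0" using f(1) M(3) by blast
      then show ?thesis using g one_smul sec_apply[OF aSec g] by simp
    next
      case False
      then show ?thesis using g K(2) smul_zero by simp
    qed
  qed
  then show "\<alpha> \<in> conj_span" using f(2) by simp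
qed

end

theorem theorem5p22:
  fixes P :: "('r::{ring, topological_ab_group_add, topological_monoid_mult}, 'l, 'w, 'g, 'v) bundle_data"
    and rG :: "'g rel" and rL :: "'l rel"
  assumes "continuous_bundle P"
    and "etale (base_space P)"
    and "locally_R_normal TYPE('r) (arrow_top (base_space P))"
    and "bundle_congruence P rG rL"
    and "local_homeomorphism (arrow_top (total_space P)) (arrow_top (base_space P)) (bundle_proj P)"
    and "zero_set_saturated P rL"
  shows "a_kernel (sectional_algebra P) (sectional_algebra (quotient_bundle P rG rL))
           (quotient_hom P rG rL)
         = generate (add_monoid (sectional_algebra P)) (conjugate_differences P rG rL)"
proof -
  interpret saturated_bundle_congruence P rG rL
    by unfold_locales (fact assms)+
  show ?thesis
    unfolding a_kernel_eq generate_eq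
    using kernel_subset_generate generate_subset_kernel by blast
qed

end
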